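(* Let $T$ be a linear operator acting on functions defined on $\mathbb{R}^n$. Fix $1<p,q<\infty$, $\theta>0$, and $1<s<\infty$. Suppose that there exists an increasing function $\phi:[1,\infty)\to[0,\infty)$ such that for all weights $w$ with $w^\theta\in A_s$ and all $f\in L^p(w^p)$, $$\|Tf\|_{L^q(w^q)}\le \phi\big([w^\theta]_{A_s}\big)\,\|f\|_{L^p(w^p)}.$$ Then, for each $b\in\mathcal{BMO}$ and for each weight $w$ and $1<\eta<\infty$ such that $w^{\theta\eta}\in A_s$, $$\big\|[T,b]f\big\|_{L^q(w^q)}\le C(\phi,w,\theta,\eta,s)\,\|b\|_{\mathcal{BMO}}\,\|f\|_{L^p(w^p)};$$ and, for every $k\ge 2$, $$\big\|[T,b]_k f\big\|_{L^q(w^q)}\le C(\phi,w,\theta,\eta,s,k)\,\|b\|_{\mathcal{BMO}}^k\,\|f\|_{L^p(w^p)},$$ where the constants $C(\cdot)$ depend only on the indicated quantities.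
   Context: A weight is a non-negative locally integrable function on $\mathbb{R}^n$; $\|f\|_{L^p(w)}=(\int_{\mathbb{R}^n}|f|^p w\,dx)^{1/p}$. Write $f_Q=\frac1{|Q|}\int_Q f\,dx$ for averages; $Q$ denotes cubes in $\mathbb{R}^n$ with sides parallel to the axes. For $1<s<\infty$, $w\in A_s$ means $$[w]_{A_s}:=\sup_Q\Big(\frac1{|Q|}\int_Q w\,dx\Big)\Big(\frac1{|Q|}\int_Q w^{1-s'}\,dx\Big)^{s-1}<\infty,\qquad \tfrac1s+\tfrac1{s'}=1.$$ $\|f\|_{\exp L,Q}:=\inf\{\lambda>0:\ \frac1{|Q|}\int_Q e^{|f|/\lambda}\,dx\le 2\}$, and $\mathcal{BMO}$ is the space of locally integrable $b$ with $\|b\|_{\mathcal{BMO}}:=\sup_Q\|b-b_Q\|_{\exp L,Q}<\infty$. Commutators (defined whenever they make sense): $[T,b]f=T(bf)-b\,Tf$, and recursively $[T,b]_1=[T,b]$, $[T,b]_k=[[T,b]_{k-1},b]$ for $k\ge2$; equivalently $[T,b]_kf(x)=T\big((b(\cdot)-b(x))^kf(\cdot)\big)(x)$. *)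

theory Defs
  imports "HOL-Analysis.Analysis"
begin

text \<open>
  Measurability, integrals and ``almost everywhere'' refer to Lebesgue measure \<open>lebesgue\<close> (the
  completion of \<open>lborel\<close>). Norms, averages of non-negative functions and suprema take values in
  \<open>[0,\<infinity>]\<close>, i.e. in \<^typ>\<open>ennreal\<close>.
\<close>

text \<open>Real powers on \<open>[0,\<infinity>]\<close>; meant for positive exponents.\<close>

definition enn_powr :: "ennreal \<Rightarrow> real \<Rightarrow> ennreal" where
  "enn_powr x a = (if x = top then top else ennreal (enn2real x powr a))"

definition cubes :: "(real^'n) set set" where
  "cubes = {cbox a (\<chi> i. a $ i + l) | a l. 0 < l}"

definition locally_integrable :: "(real^'n \<Rightarrow> 'b::{banach, second_countable_topology}) \<Rightarrow> bool" where
  "locally_integrable f \<longleftrightarrow> (\<forall>K. compact K \<longrightarrow> set_integrable lebesgue K f)"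

definition average :: "(real^'n) set \<Rightarrow> (real^'n \<Rightarrow> 'b::{banach, second_countable_topology}) \<Rightarrow> 'b" where
  "average Q f = (LINT x:Q|lebesgue. f x) /\<^sub>R measure lebesgue Q"

definition nn_average :: "(real^'n) set \<Rightarrow> (real^'n \<Rightarrow> real) \<Rightarrow> ennreal" where
  "nn_average Q f = (\<integral>\<^sup>+x\<in>Q. ennreal (f x) \<partial>lebesgue) / emeasure lebesgue Q"

definition weight :: "(real^'n \<Rightarrow> real) \<Rightarrow> bool" where
  "weight w \<longleftrightarrow> (\<forall>x. 0 \<le> w x) \<and> locally_integrable w"

text \<open>
  With \<open>1/s + 1/s' = 1\<close> one has \<open>s' = s / (s - 1)\<close>. The power \<open>w\<^sup>1\<^sup>-\<^sup>s\<^sup>'\<close> has a negative exponent and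
  is \<open>\<infinity>\<close> where \<open>w\<close> vanishes, whereas \<open>0 powr a = 0\<close> here. Membership in \<open>A\<^sub>s\<close> therefore includes
  that \<open>w > 0\<close> almost everywhere. A weight vanishing on a set of positive measure has infinite
  \<open>A\<^sub>s\<close> constant anyway, apart from the weight zero, excluded under the usual reading
  \<open>0 \<cdot> \<infinity> = \<infinity>\<close>.
\<close>

definition conj_exp :: "real \<Rightarrow> real" where
  "conj_exp s = s / (s - 1)"

definition A_const :: "real \<Rightarrow> (real^'n \<Rightarrow> real) \<Rightarrow> ennreal" where
  "A_const s w = (SUP Q\<in>cubes.
     nn_average Q w * enn_powr (nn_average Q (\<lambda>x. w x powr (1 - conj_exp s))) (s - 1))"

definition A_class :: "real \<Rightarrow> (real^'n \<Rightarrow> real) set" where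
  "A_class s = {w. weight w \<and> (AE x in lebesgue. 0 < w x) \<and> A_const s w < top}"

text \<open>The infimum over the empty set is \<open>\<infinity>\<close>.\<close>

definition expL_norm :: "(real^'n) set \<Rightarrow> (real^'n \<Rightarrow> complex) \<Rightarrow> ennreal" where
  "expL_norm Q f = Inf {ennreal l | l. 0 < l \<and> nn_average Q (\<lambda>x. exp (norm (f x) / l)) \<le> 2}"

definition bmo_norm :: "(real^'n \<Rightarrow> complex) \<Rightarrow> ennreal" where
  "bmo_norm b = (SUP Q\<in>cubes. expL_norm Q (\<lambda>x. b x - average Q b))"

definition BMO :: "(real^'n \<Rightarrow> complex) set" where
  "BMO = {b. locally_integrable b \<and> bmo_norm b < top}"

definition Lp_norm :: "real \<Rightarrow> (real^'n \<Rightarrow> real) \<Rightarrow> (real^'n \<Rightarrow> complex) \<Rightarrow> ennreal" where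
  "Lp_norm p w f = enn_powr (\<integral>\<^sup>+x. ennreal (norm (f x) powr p * w x) \<partial>lebesgue) (1 / p)"

definition Lp :: "real \<Rightarrow> (real^'n \<Rightarrow> real) \<Rightarrow> (real^'n \<Rightarrow> complex) set" where
  "Lp p w = {f \<in> borel_measurable lebesgue. Lp_norm p w f < top}"

text \<open>
  A linear operator with domain the linear space \<open>D\<close> of functions. The values outside \<open>D\<close> of the
  HOL function \<open>T\<close> are irrelevant, and, as usual for operators on Lebesgue spaces, its values
  on \<open>D\<close> are determined only up to null sets, so linearity is required almost everywhere.
\<close>

definition linear_operator_on ::
    "(real^'n \<Rightarrow> complex) set \<Rightarrow> ((real^'n \<Rightarrow> complex) \<Rightarrow> (real^'n \<Rightarrow> complex)) \<Rightarrow> bool" where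
  "linear_operator_on D T \<longleftrightarrow>
     (\<forall>f\<in>D. \<forall>g\<in>D. \<forall>\<alpha> \<beta>. (\<lambda>x. \<alpha> * f x + \<beta> * g x) \<in> D \<and>
        (AE x in lebesgue. T (\<lambda>y. \<alpha> * f y + \<beta> * g y) x = \<alpha> * T f x + \<beta> * T g x))"

definition commutator ::
    "((real^'n \<Rightarrow> complex) \<Rightarrow> (real^'n \<Rightarrow> complex)) \<Rightarrow> (real^'n \<Rightarrow> complex) \<Rightarrow>
     (real^'n \<Rightarrow> complex) \<Rightarrow> (real^'n \<Rightarrow> complex)" where
  "commutator T b f = (\<lambda>x. T (\<lambda>y. b y * f y) x - b x * T f x)"

text \<open>The recursion is started at \<open>[T,b]\<^sub>0 = T\<close>, so that \<open>[T,b]\<^sub>1 = [T,b]\<close>.\<close>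

primrec iterated_commutator ::
    "((real^'n \<Rightarrow> complex) \<Rightarrow> (real^'n \<Rightarrow> complex)) \<Rightarrow> (real^'n \<Rightarrow> complex) \<Rightarrow> nat \<Rightarrow>
     (real^'n \<Rightarrow> complex) \<Rightarrow> (real^'n \<Rightarrow> complex)" where
  "iterated_commutator T b 0 = T"
| "iterated_commutator T b (Suc k) = commutator (iterated_commutator T b k) b"

end

theory Submission
  imports Defs
begin

text \<open>
  The conjugation method: \<open>[T,b]\<^sub>k f / k!\<close> is the \<open>k\<close>-th Taylor coefficient at \<open>0\<close> of
  \<open>F(z) = exp(-zb) T(exp(zb) f)\<close>, and the norm of \<open>F(z)\<close> with weight \<open>w\<close> is the norm of
  \<open>T(exp(zb) f)\<close> with weight \<open>w exp(-Re(zb))\<close>. By Hoelder's inequality with exponent \<open>\<eta>\<close>, the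
  \<open>A\<^sub>s\<close> constant of the \<open>\<theta>\<close>-th power of that weight stays bounded as long as \<open>\<bar>z\<bar>\<close> times the BMO
  norm of \<open>b\<close> is small. Hence \<open>F\<close> is bounded by \<open>\<Phi>\<close> times the norm of \<open>f\<close> on a circle \<open>\<bar>z\<bar> = r\<close>, and
  Cauchy's estimate gives the factor \<open>k! \<Phi> / r\<^sup>k\<close>.

  The Taylor expansion of \<open>F\<close> holds almost everywhere for each fixed \<open>z\<close>: for \<open>\<rho> > r\<close> all functions
  \<open>b\<^sup>j f\<close> and \<open>exp(zb) f\<close> are \<open>p\<close>-integrable for the single weight \<open>w exp(-\<rho>\<bar>b\<bar>)\<close>, and in that space
  the Taylor remainders of \<open>exp(zb) f\<close> decay geometrically. To use only countably many \<open>z\<close>, the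
  integral over the circle is replaced by averages over roots of unity, followed by Fatou's lemma.

  The weight \<open>w exp(-Re(zb))\<close> need not be locally integrable when \<open>\<theta>\<eta> < 1\<close>. Therefore \<open>w\<close> is
  truncated to \<open>min(w, M)\<close>, which is harmless for the \<open>A\<^sub>s\<close> constants, and \<open>M\<close> tends to infinity in
  the same application of Fatou's lemma.
\<close>

section \<open>Averages over cubes\<close>

lemma cubesE:
  assumes "Q \<in> (cubes :: (real^'n) set set)"
  obtains a l where "Q = cbox a (\<chi> i. a $ i + l)" "0 < l"
  using assms unfolding cubes_def by blast

lemma cube_compact: "Q \<in> cubes \<Longrightarrow> compact Q"
  by (auto elim!: cubesE)

lemma cube_sets [measurable]: "Q \<in> cubes \<Longrightarrow> Q \<in> sets lebesgue"
  by (auto elim!: cubesE)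

lemma cube_emeasure_finite: "Q \<in> cubes \<Longrightarrow> emeasure lebesgue Q < \<infinity>"
  using lmeasurable_compact[OF cube_compact] unfolding fmeasurable_def by blast

lemma cube_emeasure_pos:
  assumes "Q \<in> (cubes :: (real^'n) set set)"
  shows "0 < emeasure lebesgue Q"
proof -
  obtain a l where Q: "Q = cbox a (\<chi> i. a $ i + l)" "0 < l"
    using cubesE[OF assms] .
  have "\<forall>i\<in>Basis. a \<bullet> i < (\<chi> i. a $ i + l) \<bullet> i"
    using \<open>0 < l\<close> by (auto simp: Basis_vec_def inner_axis)
  then have "0 < measure lborel Q"
    unfolding Q(1) content_pos_lt_eq by blast
  then have "emeasure lborel Q \<noteq> 0"
    by (auto simp: measure_def)
  then show ?thesis
    using Q(1) by (simp add: zero_less_iff_neq_zero)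
qed

lemma bounded_subset_cube:
  fixes K :: "(real^'n) set"
  assumes "bounded K"
  obtains Q where "Q \<in> cubes" "K \<subseteq> Q"
proof -
  obtain B where B: "\<And>x. x \<in> K \<Longrightarrow> norm x \<le> B"
    using assms unfolding bounded_iff by blast
  define C where "C = \<bar>B\<bar> + 1"
  define Q :: "(real^'n) set" where "Q = cbox (\<chi> i. - C) (\<chi> i. (\<chi> i. - C) $ i + 2 * C)"
  have "Q \<in> (cubes :: (real^'n) set set)"
    unfolding Q_def cubes_def by (intro CollectI exI conjI, rule refl) (simp add: C_def)
  moreover have "K \<subseteq> Q"
  proof
    fix x assume "x \<in> K"
    then have "\<bar>x $ i\<bar> \<le> C" for i
      using B[of x] component_le_norm_cart[of x i] unfolding C_def by linarith
    then show "x \<in> Q"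
      unfolding Q_def mem_box_cart by (simp add: abs_le_iff minus_le_iff)
  qed
  ultimately show ?thesis using that by blast
qed

text \<open>Averages become integrals against the normalised Lebesgue measure on \<open>Q\<close>, a
  probability measure, so that facts about integrals over arbitrary measures, such as Hoelder's
  inequality, apply to them.\<close>

lemma nn_average_eq_nn_integral:
  fixes f :: "real^'n \<Rightarrow> real"
  assumes "Q \<in> cubes" "f \<in> borel_measurable lebesgue"
  shows "nn_average Q f = (\<integral>\<^sup>+x. ennreal (f x) \<partial>uniform_measure lebesgue Q)"
  unfolding nn_average_def using assms by (subst nn_integral_uniform_measure) auto

lemma emeasure_uniform_cube_space:
  fixes Q :: "(real^'n) set"
  assumes "Q \<in> cubes"
  shows "emeasure (uniform_measure lebesgue Q) (space lebesgue) = 1"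
proof -
  have "Q \<inter> space lebesgue = Q" by simp
  then show ?thesis
    using cube_emeasure_pos[OF assms] cube_emeasure_finite[OF assms]
      emeasure_uniform_measure[OF cube_sets[OF assms] sets.top]
    by (simp add: ennreal_divide_self del: emeasure_completion)
qed

lemma AE_uniform_cube:
  fixes Q :: "(real^'n) set"
  assumes "Q \<in> cubes" "AE x in lebesgue. P x"
  shows "AE x in uniform_measure lebesgue Q. P x"
  using assms by (intro AE_uniform_measureI cube_sets) auto

text \<open>The function is the pointwise limit of its restrictions to the balls of radius
  \<open>n\<close>, and these are integrable, hence measurable.\<close>

lemma locally_integrable_measurable:
  fixes f :: "real^'n \<Rightarrow> 'b::{banach, second_countable_topology}"
  assumes "locally_integrable f"
  shows "f \<in> borel_measurable lebesgue"
proof (rule borel_measurable_LIMSEQ_metric)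
  show "(\<lambda>x. indicator (cball 0 (real n)) x *\<^sub>R f x) \<in> borel_measurable lebesgue" for n
    using assms borel_measurable_integrable[of lebesgue "\<lambda>x. indicator (cball 0 (real n)) x *\<^sub>R f x"]
    unfolding locally_integrable_def set_integrable_def by simp
  show "(\<lambda>n. indicator (cball 0 (real n)) x *\<^sub>R f x) \<longlonglongrightarrow> f x" if "x \<in> space lebesgue" for x
  proof (rule tendsto_eventually)
    obtain n where "norm x \<le> real n" using real_arch_simple by blast
    then show "\<forall>\<^sub>F n in sequentially. indicator (cball 0 (real n)) x *\<^sub>R f x = f x"
      by (intro eventually_sequentiallyI[of n]) (auto simp: indicator_def)
  qed
qed

text \<open>Every compact set lies in a cube, and cubes have positive finite measure, so
  integrability needs to be tested on cubes only.\<close>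

lemma locally_integrable_iff_nn_average:
  fixes f :: "real^'n \<Rightarrow> real"
  assumes [measurable]: "f \<in> borel_measurable lebesgue" and "\<And>x. 0 \<le> f x"
  shows "locally_integrable f \<longleftrightarrow> (\<forall>Q\<in>cubes. nn_average Q f < top)"
proof -
  have fin: "nn_average Q f < top \<longleftrightarrow> set_integrable lebesgue Q f" if Q: "Q \<in> cubes" for Q
  proof -
    have [measurable]: "Q \<in> sets lebesgue" using cube_sets Q .
    have "(\<lambda>x. indicator Q x *\<^sub>R f x) \<in> borel_measurable lebesgue" by measurable
    moreover have "ennreal (norm (indicator Q x *\<^sub>R f x)) = ennreal (f x) * indicator Q x" for x
      using assms(2)[of x] by (simp add: indicator_def)
    ultimately have "set_integrable lebesgue Q f \<longleftrightarrow> (\<integral>\<^sup>+x\<in>Q. ennreal (f x) \<partial>lebesgue) < top"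
      unfolding set_integrable_def integrable_iff_bounded by simp
    moreover have "emeasure lebesgue Q \<noteq> 0" "emeasure lebesgue Q \<noteq> top"
      using cube_emeasure_pos[OF Q] cube_emeasure_finite[OF Q] by auto
    ultimately show ?thesis
      unfolding nn_average_def by (simp add: ennreal_divide_eq_top_iff less_top[symmetric] del: emeasure_completion)
  qed
  show ?thesis
  proof
    assume "locally_integrable f"
    then show "\<forall>Q\<in>cubes. nn_average Q f < top"
      using fin cube_compact unfolding locally_integrable_def by blast
  next
    assume *: "\<forall>Q\<in>cubes. nn_average Q f < top"
    show "locally_integrable f"
      unfolding locally_integrable_def
    proof (intro allI impI)
      fix K :: "(real^'n) set" assume "compact K"
      then obtain Q where "Q \<in> cubes" "K \<subseteq> Q"
        using bounded_subset_cube compact_imp_bounded by metis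
      then show "set_integrable lebesgue K f"
        by (intro set_integrable_subset[of lebesgue Q f K] fmeasurableD lmeasurable_compact) (use * fin \<open>compact K\<close> in auto)
    qed
  qed
qed

text \<open>Young's inequality for the normalised functions \<open>f / A powr (1 / p)\<close> and
  \<open>g / B powr (1 / q)\<close>, integrated and multiplied by the claimed bound
  \<open>C\<close>. Working with positive upper bounds \<open>A\<close> and \<open>B\<close> instead
  of the integrals themselves avoids the cases where an integral is zero or infinite.\<close>

lemma nn_integral_Holder:
  fixes f g :: "'a \<Rightarrow> real"
  assumes [measurable]: "f \<in> borel_measurable M" "g \<in> borel_measurable M"
    and nonneg: "\<And>x. 0 \<le> f x" "\<And>x. 0 \<le> g x"
    and pq: "1 < p" "1 < q" "1 / p + 1 / q = 1"
    and AB: "0 < A" "0 < B"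
    and f: "(\<integral>\<^sup>+x. ennreal (f x powr p) \<partial>M) \<le> ennreal A"
    and g: "(\<integral>\<^sup>+x. ennreal (g x powr q) \<partial>M) \<le> ennreal B"
  shows "(\<integral>\<^sup>+x. ennreal (f x * g x) \<partial>M) \<le> ennreal (A powr (1 / p) * B powr (1 / q))"
proof -
  define C where "C = A powr (1 / p) * B powr (1 / q)"
  have C: "0 < C" using AB by (simp add: C_def)
  have young: "f x * g x \<le> C / (A * p) * f x powr p + C / (B * q) * g x powr q" for x
  proof -
    define a where "a = f x / A powr (1 / p)"
    define b where "b = g x / B powr (1 / q)"
    have "a * b \<le> a powr p / p + b powr q / q"
      using nonneg[of x] pq by (intro Youngs_inequality) (auto simp: a_def b_def)
    moreover have "a powr p = f x powr p / A" "b powr q = g x powr q / B"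
      using AB nonneg pq unfolding a_def b_def by (auto simp: powr_divide powr_powr)
    ultimately have "C * (a * b) \<le> C * (f x powr p / A / p + g x powr q / B / q)"
      using C by (intro mult_left_mono) auto
    moreover have "C * (a * b) = f x * g x"
      using AB by (simp add: C_def a_def b_def)
    ultimately show ?thesis by (simp add: field_simps)
  qed
  have "(\<integral>\<^sup>+x. ennreal (f x * g x) \<partial>M)
      \<le> (\<integral>\<^sup>+x. ennreal (C / (A * p)) * ennreal (f x powr p) + ennreal (C / (B * q)) * ennreal (g x powr q) \<partial>M)"
    using AB C pq young
    by (intro nn_integral_mono) (simp add: ennreal_mult[symmetric] ennreal_plus[symmetric] del: ennreal_plus)
  also have "\<dots> = ennreal (C / (A * p)) * (\<integral>\<^sup>+x. ennreal (f x powr p) \<partial>M)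
      + ennreal (C / (B * q)) * (\<integral>\<^sup>+x. ennreal (g x powr q) \<partial>M)"
    by (simp add: nn_integral_add nn_integral_cmult)
  also have "\<dots> \<le> ennreal (C / (A * p)) * ennreal A + ennreal (C / (B * q)) * ennreal B"
    by (intro add_mono mult_left_mono f g) auto
  also have "\<dots> = ennreal (C / p + C / q)"
    using AB C pq by (simp add: ennreal_mult[symmetric] ennreal_plus[symmetric] del: ennreal_plus)
  also have "C / p + C / q = C"
    using pq(3) by (simp add: divide_inverse flip: distrib_left)
  finally show ?thesis by (simp add: C_def)
qed

section \<open>Extended real powers and elementary rules for averages\<close>

lemma enn_powr_ennreal: "0 \<le> x \<Longrightarrow> enn_powr (ennreal x) a = ennreal (x powr a)"
  by (simp add: enn_powr_def)

lemma enn_powr_mono: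
  assumes "x \<le> y" "0 \<le> a"
  shows "enn_powr x a \<le> enn_powr y a"
proof (cases "y = top")
  case False
  then have "x < top" "y < top"
    using assms by (auto simp: less_top[symmetric] top_unique)
  then show ?thesis
    using assms by (auto simp: enn_powr_def intro!: powr_mono2 enn2real_mono ennreal_leI)
qed (simp add: enn_powr_def)

lemma conj_exp:
  assumes "1 < s"
  shows "1 < conj_exp s" "1 / s + 1 / conj_exp s = 1" "1 - conj_exp s = - 1 / (s - 1)"
  using assms by (auto simp: conj_exp_def field_simps)

lemma nn_integral_pos:
  assumes "f \<in> borel_measurable M" "AE x in M. 0 < f x" "emeasure M (space M) \<noteq> 0"
  shows "0 < (\<integral>\<^sup>+x. ennreal (f x) \<partial>M)"
proof (rule ccontr)
  assume "\<not> 0 < (\<integral>\<^sup>+x. ennreal (f x) \<partial>M)"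
  then have "AE x in M. ennreal (f x) = 0"
    using assms(1) by (subst nn_integral_0_iff_AE[symmetric]) auto
  with assms(2) have "AE x in M. False"
    by eventually_elim simp
  then show False
    using assms(3) by (simp add: AE_iff_measurable[where N="space M"])
qed

lemma nn_average_pos:
  fixes u :: "real^'n \<Rightarrow> real"
  assumes "Q \<in> cubes" "u \<in> borel_measurable lebesgue" "AE x in lebesgue. 0 < u x"
  shows "0 < nn_average Q u"
proof -
  have "0 < (\<integral>\<^sup>+x. ennreal (u x) \<partial>uniform_measure lebesgue Q)"
    using assms emeasure_uniform_cube_space[OF assms(1)]
    by (intro nn_integral_pos AE_uniform_cube)
      (auto simp: measurable_cong_sets[OF sets_uniform_measure refl] simp del: emeasure_uniform_measure)
  then show ?thesis
    using assms by (simp add: nn_average_eq_nn_integral)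
qed

lemma nn_average_mono:
  assumes "\<And>x. x \<in> Q \<Longrightarrow> f x \<le> g x"
  shows "nn_average Q f \<le> nn_average Q g"
  unfolding nn_average_def
  by (intro divide_right_mono_ennreal nn_integral_mono) (auto simp: indicator_def intro!: ennreal_leI assms)

lemma nn_average_const:
  fixes Q :: "(real^'n) set"
  assumes "Q \<in> cubes"
  shows "nn_average Q (\<lambda>x. c) = ennreal c"
  using assms emeasure_uniform_cube_space[OF assms]
  by (subst nn_average_eq_nn_integral) (auto simp del: emeasure_uniform_measure)

lemma nn_average_add:
  fixes f g :: "real^'n \<Rightarrow> real"
  assumes "Q \<in> cubes" "f \<in> borel_measurable lebesgue" "g \<in> borel_measurable lebesgue"
    and "\<And>x. 0 \<le> f x" "\<And>x. 0 \<le> g x"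
  shows "nn_average Q (\<lambda>x. f x + g x) = nn_average Q f + nn_average Q g"
  using assms by (simp add: nn_average_eq_nn_integral nn_integral_add)

lemma nn_average_cmult:
  fixes f :: "real^'n \<Rightarrow> real"
  assumes "Q \<in> cubes" "f \<in> borel_measurable lebesgue" "0 \<le> c"
  shows "nn_average Q (\<lambda>x. c * f x) = ennreal c * nn_average Q f"
  using assms by (simp add: nn_average_eq_nn_integral ennreal_mult' nn_integral_cmult)

lemma nn_average_Holder:
  fixes f g :: "real^'n \<Rightarrow> real"
  assumes "Q \<in> cubes"
    and m: "f \<in> borel_measurable lebesgue" "g \<in> borel_measurable lebesgue"
    and "\<And>x. 0 \<le> f x" "\<And>x. 0 \<le> g x"
    and "1 < p" "0 < A" "0 < B"
    and f: "nn_average Q (\<lambda>x. f x powr p) \<le> ennreal A"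
    and g: "nn_average Q (\<lambda>x. g x powr conj_exp p) \<le> ennreal B"
  shows "nn_average Q (\<lambda>x. f x * g x) \<le> ennreal (A powr (1 / p) * B powr (1 / conj_exp p))"
proof -
  note [measurable] = m
  have "(\<lambda>x. f x powr p) \<in> borel_measurable lebesgue"
    "(\<lambda>x. g x powr conj_exp p) \<in> borel_measurable lebesgue"
    "(\<lambda>x. f x * g x) \<in> borel_measurable lebesgue" by measurable
  with assms conj_exp[OF \<open>1 < p\<close>] show ?thesis
    by (simp add: nn_average_eq_nn_integral)
      (intro nn_integral_Holder, auto simp: measurable_cong_sets[OF sets_uniform_measure refl])
qed

section \<open>Muckenhoupt classes\<close>

lemma A_class_measurable:
  "u \<in> A_class s \<Longrightarrow> u \<in> borel_measurable lebesgue"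
  unfolding A_class_def weight_def by (auto intro: locally_integrable_measurable)

text \<open>On a cube both averages in the Muckenhoupt condition are positive and finite, so one can
  compute with real numbers \<open>A\<close> and \<open>B\<close>. The lower bound on their product
  is Hoelder's inequality for 1 = \<open>u powr (1 / s) * u powr (- 1 / s)\<close>.\<close>

lemma A_class_cubeE:
  fixes u :: "real^'n \<Rightarrow> real"
  assumes u: "u \<in> A_class s" and s: "1 < s" and K: "A_const s u \<le> ennreal K" and Q: "Q \<in> cubes"
  obtains A B where "0 < A" "0 < B" "nn_average Q u = ennreal A"
    "nn_average Q (\<lambda>x. u x powr (1 - conj_exp s)) = ennreal B"
    "1 \<le> A * B powr (s - 1)" "A * B powr (s - 1) \<le> K"
proof -
  have [measurable]: "u \<in> borel_measurable lebesgue" using u by (rule A_class_measurable)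
  have u0: "\<And>x. 0 \<le> u x" and pos: "AE x in lebesgue. 0 < u x" and "locally_integrable u"
    using u unfolding A_class_def weight_def by auto
  let ?U = "nn_average Q u" and ?V = "nn_average Q (\<lambda>x. u x powr (1 - conj_exp s))"
  have "?U < top"
    using locally_integrable_iff_nn_average[of u] \<open>locally_integrable u\<close> u0 Q by auto
  moreover have "0 < ?U" using nn_average_pos[OF Q _ pos] by simp
  moreover have V0: "0 < ?V"
    using pos by (intro nn_average_pos[OF Q]) auto
  moreover have UV: "?U * enn_powr ?V (s - 1) \<le> ennreal K"
    using K Q unfolding A_const_def by (simp add: SUP_le_iff)
  \<comment> \<open>An infinite second average would make the product infinite, because the first
    one is positive.\<close>
  moreover have "?V < top"
  proof (rule ccontr)
    assume "\<not> ?V < top"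
    then have "enn_powr ?V (s - 1) = top" by (simp add: enn_powr_def less_top)
    with UV \<open>0 < ?U\<close> show False by (auto simp: ennreal_mult_top top_unique split: if_splits)
  qed
  moreover define A B where "A = enn2real ?U" "B = enn2real ?V"
  ultimately have AB: "?U = ennreal A" "?V = ennreal B" "0 < A" "0 < B"
    by (auto simp: enn2real_positive_iff)
  have "A * B powr (s - 1) \<le> K"
    using UV AB by (simp add: enn_powr_ennreal ennreal_mult[symmetric] ennreal_le_iff2)
      (smt (verit) mult_pos_pos powr_gt_zero)
  have c: "1 < conj_exp s" "1 / s + 1 / conj_exp s = 1" "1 - conj_exp s = - 1 / (s - 1)"
    using conj_exp[OF s] by auto
  have "nn_average Q (\<lambda>x. u x powr (1 / s) * u x powr (- 1 / s)) \<le>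
      ennreal (A powr (1 / s) * B powr (1 / conj_exp s))"
  proof (rule nn_average_Holder[OF Q])
    show "nn_average Q (\<lambda>x. (u x powr (1 / s)) powr s) \<le> ennreal A"
      using u0 s AB by (simp add: powr_powr)
    have "- 1 / s * conj_exp s = 1 - conj_exp s"
      using s by (simp add: conj_exp_def field_simps)
    then show "nn_average Q (\<lambda>x. (u x powr (- 1 / s)) powr conj_exp s) \<le> ennreal B"
      using AB by (simp add: powr_powr)
  qed (use AB s in auto)
  \<comment> \<open>The product is 1 wherever \<open>u\<close> is positive, hence almost
    everywhere.\<close>
  moreover have "nn_average Q (\<lambda>x. u x powr (1 / s) * u x powr (- 1 / s)) = 1"
  proof -
    have "nn_average Q (\<lambda>x. u x powr (1 / s) * u x powr (- 1 / s)) = nn_average Q (\<lambda>x. 1)"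
      unfolding nn_average_def
      by (rule arg_cong2[where f="(/)"], rule nn_integral_cong_AE)
        (use pos in eventually_elim, auto simp: powr_add[symmetric])
    then show ?thesis by (simp add: nn_average_const[OF Q])
  qed
  ultimately have "1 \<le> A powr (1 / s) * B powr (1 / conj_exp s)"
    by simp
  then have "1 powr s \<le> (A powr (1 / s) * B powr (1 / conj_exp s)) powr s"
    using s by (intro powr_mono2) auto
  moreover have "1 / conj_exp s * s = s - 1"
    using s by (simp add: conj_exp_def field_simps)
  ultimately have "1 \<le> A * B powr (s - 1)"
    using AB s by (simp add: powr_mult powr_powr)
  with AB \<open>A * B powr (s - 1) \<le> K\<close> show ?thesis by (intro that) auto
qed

lemma cubes_nonempty: "\<exists>Q. Q \<in> (cubes :: (real^'n) set set)"
  using bounded_subset_cube[of "{}"] by auto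

text \<open>Any single cube already gives the bound 1. This places the constant in the domain of the
  increasing function \<phi>, which is controlled on \<open>{1..}\<close> only.\<close>

lemma A_const_ge_1:
  fixes u :: "real^'n \<Rightarrow> real"
  assumes u: "u \<in> A_class s" and s: "1 < s"
  shows "1 \<le> A_const s u"
proof -
  obtain Q :: "(real^'n) set" where Q: "Q \<in> cubes" using cubes_nonempty by blast
  have "A_const s u < top" using u by (simp add: A_class_def)
  then obtain K where K: "A_const s u = ennreal K"
    by (cases "A_const s u") auto
  obtain A B where "1 \<le> A * B powr (s - 1)" "A * B powr (s - 1) \<le> K"
    by (rule A_class_cubeE[OF u s eq_refl[OF K] Q])
  then show ?thesis unfolding K by simp
qed

lemma A_classI:
  fixes u :: "real^'n \<Rightarrow> real"
  assumes "u \<in> borel_measurable lebesgue" "\<And>x. 0 \<le> u x" "AE x in lebesgue. 0 < u x" "1 < s"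
    and *: "\<And>Q. Q \<in> cubes \<Longrightarrow> \<exists>A B. 0 \<le> A \<and> 0 \<le> B \<and> nn_average Q u \<le> ennreal A \<and>
      nn_average Q (\<lambda>x. u x powr (1 - conj_exp s)) \<le> ennreal B \<and> A * B powr (s - 1) \<le> K"
  shows "u \<in> A_class s" "A_const s u \<le> ennreal K"
proof -
  have "nn_average Q u < top" if "Q \<in> cubes" for Q
    using *[OF that] by (auto simp: le_less_trans)
  then have "weight u"
    using assms locally_integrable_iff_nn_average[of u] by (auto simp: weight_def)
  moreover show K: "A_const s u \<le> ennreal K"
    unfolding A_const_def
  proof (rule SUP_least)
    fix Q :: "(real^'n) set" assume "Q \<in> cubes"
    then obtain A B where AB: "0 \<le> A" "0 \<le> B" "nn_average Q u \<le> ennreal A"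
      "nn_average Q (\<lambda>x. u x powr (1 - conj_exp s)) \<le> ennreal B" "A * B powr (s - 1) \<le> K"
      using * by blast
    then have "nn_average Q u * enn_powr (nn_average Q (\<lambda>x. u x powr (1 - conj_exp s))) (s - 1)
      \<le> ennreal A * enn_powr (ennreal B) (s - 1)"
      using \<open>1 < s\<close> by (intro mult_mono enn_powr_mono) auto
    also have "\<dots> \<le> ennreal K"
      using AB by (simp add: enn_powr_ennreal ennreal_mult[symmetric] ennreal_leI)
    finally show "nn_average Q u * enn_powr (nn_average Q (\<lambda>x. u x powr (1 - conj_exp s))) (s - 1) \<le> ennreal K" .
  qed
  ultimately show "u \<in> A_class s"
    using assms(3) le_less_trans[OF K] by (auto simp: A_class_def)
qed

text \<open>The exponent 1 - s' is negative, but the minimum always equals \<open>u x\<close> or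
  \<open>m\<close>, so its power is at most the sum of the two powers. The first average is
  therefore at most \<open>min A m\<close> and the second at most \<open>B + c\<close>. The
  resulting constant does not depend on the truncation level \<open>m\<close>.\<close>

lemma A_class_min:
  fixes u :: "real^'n \<Rightarrow> real"
  assumes u: "u \<in> A_class s" and s: "1 < s" and K: "A_const s u \<le> ennreal K" and "0 < m"
  shows "(\<lambda>x. min (u x) m) \<in> A_class s" "A_const s (\<lambda>x. min (u x) m) \<le> ennreal (2 powr (s - 1) * K)"
proof -
  have [measurable]: "u \<in> borel_measurable lebesgue" using u by (rule A_class_measurable)
  have u0: "\<And>x. 0 \<le> u x" and pos: "AE x in lebesgue. 0 < u x"
    using u unfolding A_class_def weight_def by auto
  have *: "\<exists>A B. 0 \<le> A \<and> 0 \<le> B \<and> nn_average Q (\<lambda>x. min (u x) m) \<le> ennreal A \<and>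
      nn_average Q (\<lambda>x. min (u x) m powr (1 - conj_exp s)) \<le> ennreal B \<and>
      A * B powr (s - 1) \<le> 2 powr (s - 1) * K" if Q: "Q \<in> cubes" for Q
  proof -
    obtain A B where AB: "0 < A" "0 < B" "nn_average Q u = ennreal A"
      "nn_average Q (\<lambda>x. u x powr (1 - conj_exp s)) = ennreal B"
      "1 \<le> A * B powr (s - 1)" "A * B powr (s - 1) \<le> K"
      using A_class_cubeE[OF u s K Q] .
    define c where "c = m powr (1 - conj_exp s)"
    have "0 < c" using \<open>0 < m\<close> by (simp add: c_def)
    have "nn_average Q (\<lambda>x. min (u x) m) \<le> ennreal (min A m)"
    proof -
      have "nn_average Q (\<lambda>x. min (u x) m) \<le> nn_average Q u"
        "nn_average Q (\<lambda>x. min (u x) m) \<le> nn_average Q (\<lambda>x. m)"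
        by (rule nn_average_mono, simp)+
      then show ?thesis
        using AB nn_average_const[OF Q, of m] by (auto simp: min_def)
    qed
    moreover have "nn_average Q (\<lambda>x. min (u x) m powr (1 - conj_exp s)) \<le> ennreal (B + c)"
    proof -
      have "nn_average Q (\<lambda>x. min (u x) m powr (1 - conj_exp s))
        \<le> nn_average Q (\<lambda>x. u x powr (1 - conj_exp s) + c)"
        by (rule nn_average_mono) (simp add: c_def min_def)
      also have "\<dots> = ennreal (B + c)"
        using AB \<open>0 < c\<close> by (subst nn_average_add[OF Q]) (auto simp: nn_average_const[OF Q])
      finally show ?thesis .
    qed
    moreover have "min A m * (B + c) powr (s - 1) \<le> 2 powr (s - 1) * K"
    proof -
      \<comment> \<open>The exponents 1 - s' and s - 1 have product -1.\<close>
      have "c powr (s - 1) = 1 / m"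
      proof -
        have "(1 - conj_exp s) * (s - 1) = - 1"
          using s by (simp add: conj_exp_def field_simps)
        then show ?thesis
          using \<open>0 < m\<close> unfolding c_def powr_powr by (simp add: powr_minus_divide)
      qed
      have "1 \<le> K" using AB by linarith
      \<comment> \<open>If \<open>B\<close> dominates, compare with the product for
        \<open>u\<close>. If \<open>c\<close> dominates, compare with that of the constant
        \<open>m\<close>, which is 1. Replacing \<open>B + c\<close> by \<open>2 * max B c\<close>
        costs the factor \<open>2 powr (s - 1)\<close>.\<close>
      have max: "min A m * max B c powr (s - 1) \<le> K"
      proof (cases "c \<le> B")
        case True
        then have "min A m * max B c powr (s - 1) \<le> A * B powr (s - 1)"
          by (intro mult_mono) (use AB in \<open>auto simp: max_def\<close>)
        with AB show ?thesis by simp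
      next
        case False
        then have "min A m * max B c powr (s - 1) \<le> m * (1 / m)"
          using \<open>0 < m\<close> \<open>c powr (s - 1) = 1 / m\<close> by (intro mult_mono) (auto simp: max_def)
        with \<open>1 \<le> K\<close> \<open>0 < m\<close> show ?thesis by simp
      qed
      have "(B + c) powr (s - 1) \<le> (2 * max B c) powr (s - 1)"
        using AB \<open>0 < c\<close> s by (intro powr_mono2) auto
      also have "\<dots> = 2 powr (s - 1) * max B c powr (s - 1)"
        using AB by (simp add: powr_mult)
      finally have "min A m * (B + c) powr (s - 1) \<le> min A m * (2 powr (s - 1) * max B c powr (s - 1))"
        using AB \<open>0 < m\<close> by (intro mult_left_mono) auto
      also have "\<dots> = 2 powr (s - 1) * (min A m * max B c powr (s - 1))" by simp
      also have "\<dots> \<le> 2 powr (s - 1) * K" by (intro mult_left_mono max) auto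
      finally show ?thesis .
    qed
    ultimately show ?thesis
      using AB \<open>0 < c\<close> \<open>0 < m\<close> by (intro exI[of _ "min A m"] exI[of _ "B + c"]) auto
  qed
  have "AE x in lebesgue. 0 < min (u x) m"
    using pos by eventually_elim (use \<open>0 < m\<close> in auto)
  then show "(\<lambda>x. min (u x) m) \<in> A_class s"
    "A_const s (\<lambda>x. min (u x) m) \<le> ennreal (2 powr (s - 1) * K)"
    using \<open>0 < m\<close> u0 s by (intro A_classI[OF _ _ _ s *]; force)+
qed

text \<open>Hoelder's inequality with exponents \<eta> and \<open>conj_exp \<eta>\<close> separates
  \<open>u\<close> from the exponential in both averages. On each cube a constant \<open>c\<close>
  may be subtracted from \<beta>, because the factors that this produces in the two averages cancel.
  Hence only exponential oscillation of \<beta> matters.\<close>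

lemma A_class_exp_mult:
  fixes u \<beta> :: "real^'n \<Rightarrow> real"
  assumes s: "1 < s" and \<eta>: "1 < \<eta>"
    and um [measurable]: "u \<in> borel_measurable lebesgue" and u0: "\<And>x. 0 \<le> u x"
    and u\<eta>: "(\<lambda>x. u x powr \<eta>) \<in> A_class s" and K: "A_const s (\<lambda>x. u x powr \<eta>) \<le> ennreal K"
    and \<beta>m [measurable]: "\<beta> \<in> borel_measurable lebesgue"
    and osc: "\<And>Q. Q \<in> cubes \<Longrightarrow> \<exists>c. nn_average Q (\<lambda>x. exp (conj_exp \<eta> * \<bar>\<beta> x - c\<bar>)) \<le> 2 \<and>
       nn_average Q (\<lambda>x. exp (conj_exp \<eta> * (conj_exp s - 1) * \<bar>\<beta> x - c\<bar>)) \<le> 2"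
  shows "(\<lambda>x. u x * exp (\<beta> x)) \<in> A_class s"
    "A_const s (\<lambda>x. u x * exp (\<beta> x)) \<le> ennreal (K powr (1 / \<eta>) * 2 powr (s / conj_exp \<eta>))"
proof -
  let ?e = "conj_exp \<eta>" and ?t = "conj_exp s - 1"
  have pos: "AE x in lebesgue. 0 < u x powr \<eta>"
    using u\<eta> unfolding A_class_def by auto
  have e: "1 < ?e" "1 / \<eta> + 1 / ?e = 1" using conj_exp[OF \<eta>] by auto
  have t: "0 < ?t" "?t * (s - 1) = 1" using s by (auto simp: conj_exp_def field_simps)
  have *: "\<exists>A B. 0 \<le> A \<and> 0 \<le> B \<and> nn_average Q (\<lambda>x. u x * exp (\<beta> x)) \<le> ennreal A \<and>
      nn_average Q (\<lambda>x. (u x * exp (\<beta> x)) powr (1 - conj_exp s)) \<le> ennreal B \<and>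
      A * B powr (s - 1) \<le> K powr (1 / \<eta>) * 2 powr (s / ?e)" if Q: "Q \<in> cubes" for Q
  proof -
    obtain A B where AB: "0 < A" "0 < B" "nn_average Q (\<lambda>x. u x powr \<eta>) = ennreal A"
      "nn_average Q (\<lambda>x. (u x powr \<eta>) powr (1 - conj_exp s)) = ennreal B"
      "1 \<le> A * B powr (s - 1)" "A * B powr (s - 1) \<le> K"
      using A_class_cubeE[OF u\<eta> s K Q] .
    obtain c where c: "nn_average Q (\<lambda>x. exp (?e * \<bar>\<beta> x - c\<bar>)) \<le> 2"
       "nn_average Q (\<lambda>x. exp (?e * ?t * \<bar>\<beta> x - c\<bar>)) \<le> 2"
      using osc[OF Q] by blast
    define D where "D = 2 powr (1 / ?e)"
    \<comment> \<open>One estimate serves both averages: with \<open>a\<close> = \<open>b\<close> =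
      1 for the weight, and with \<open>a\<close> = \<open>b\<close> = \<open>- ?t\<close> = 1 - s'
      for its dual power.\<close>
    have H: "nn_average Q (\<lambda>x. u x powr a * exp (b * (\<beta> x - c))) \<le> ennreal (E powr (1 / \<eta>) * D)"
      if E: "0 < E" "nn_average Q (\<lambda>x. u x powr (\<eta> * a)) \<le> ennreal E"
        and b: "nn_average Q (\<lambda>x. exp (?e * \<bar>b\<bar> * \<bar>\<beta> x - c\<bar>)) \<le> 2" for a b E
      unfolding D_def
    proof (rule nn_average_Holder[OF Q])
      show "nn_average Q (\<lambda>x. (u x powr a) powr \<eta>) \<le> ennreal E"
        using E by (simp add: powr_powr mult.commute)
      have "nn_average Q (\<lambda>x. exp (b * (\<beta> x - c)) powr ?e)
          \<le> nn_average Q (\<lambda>x. exp (?e * \<bar>b\<bar> * \<bar>\<beta> x - c\<bar>))"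
      proof (rule nn_average_mono)
        fix x
        have "b * (\<beta> x - c) \<le> \<bar>b\<bar> * \<bar>\<beta> x - c\<bar>"
          by (metis abs_ge_self abs_mult)
        then have "?e * (b * (\<beta> x - c)) \<le> ?e * (\<bar>b\<bar> * \<bar>\<beta> x - c\<bar>)"
          using e by (intro mult_left_mono) auto
        then show "exp (b * (\<beta> x - c)) powr ?e \<le> exp (?e * \<bar>b\<bar> * \<bar>\<beta> x - c\<bar>)"
          by (simp add: exp_powr_real mult.commute mult.left_commute)
      qed
      also note b
      finally show "nn_average Q (\<lambda>x. exp (b * (\<beta> x - c)) powr ?e) \<le> ennreal 2" by simp
    qed (use E \<eta> in auto)
    have "nn_average Q (\<lambda>x. u x * exp (\<beta> x)) \<le> ennreal (exp c * (A powr (1 / \<eta>) * D))"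
    proof -
      have "nn_average Q (\<lambda>x. u x * exp (\<beta> x)) = nn_average Q (\<lambda>x. exp c * (u x powr 1 * exp (1 * (\<beta> x - c))))"
        using u0 by (simp add: exp_diff)
      also have "\<dots> = ennreal (exp c) * nn_average Q (\<lambda>x. u x powr 1 * exp (1 * (\<beta> x - c)))"
        by (intro nn_average_cmult[OF Q]) auto
      also have "\<dots> \<le> ennreal (exp c) * ennreal (A powr (1 / \<eta>) * D)"
        by (intro mult_left_mono H) (use AB c in auto)
      finally show ?thesis by (simp add: ennreal_mult')
    qed
    moreover have "nn_average Q (\<lambda>x. (u x * exp (\<beta> x)) powr (1 - conj_exp s))
        \<le> ennreal (exp (- ?t * c) * (B powr (1 / \<eta>) * D))"
    proof -
      have "nn_average Q (\<lambda>x. (u x * exp (\<beta> x)) powr (1 - conj_exp s))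
          = nn_average Q (\<lambda>x. exp (- ?t * c) * (u x powr (- ?t) * exp (- ?t * (\<beta> x - c))))"
        unfolding nn_average_def
      proof (intro arg_cong2[where f="(/)"] nn_integral_cong refl)
        fix x
        have "exp (\<beta> x) powr (1 - conj_exp s) = exp (- ?t * c) * exp (- ?t * (\<beta> x - c))"
          by (simp add: exp_powr_real exp_add[symmetric] algebra_simps)
        then show "ennreal ((u x * exp (\<beta> x)) powr (1 - conj_exp s)) * indicator Q x =
          ennreal (exp (- ?t * c) * (u x powr (- ?t) * exp (- ?t * (\<beta> x - c)))) * indicator Q x"
          using u0[of x] by (simp add: powr_mult mult.left_commute)
      qed
      also have "\<dots> = ennreal (exp (- ?t * c)) * nn_average Q (\<lambda>x. u x powr (- ?t) * exp (- ?t * (\<beta> x - c)))"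
        by (intro nn_average_cmult[OF Q]) auto
      also have "\<dots> \<le> ennreal (exp (- ?t * c)) * ennreal (B powr (1 / \<eta>) * D)"
        by (intro mult_left_mono H) (use AB c t in \<open>auto simp: powr_powr\<close>)
      finally show ?thesis by (simp add: ennreal_mult')
    qed
    \<comment> \<open>Since \<open>?t * (s - 1) = 1\<close>, raising the second bound to the power s
      - 1 turns its factor \<open>exp (- ?t * c)\<close> into \<open>exp (- c)\<close>, which
      cancels \<open>exp c\<close>. The powers of \<open>D\<close> combine to \<open>D\<close> to
      the power \<open>s\<close>.\<close>
    moreover have "exp c * (A powr (1 / \<eta>) * D) * (exp (- ?t * c) * (B powr (1 / \<eta>) * D)) powr (s - 1)
        \<le> K powr (1 / \<eta>) * 2 powr (s / ?e)"
    proof -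
      have "exp (- ?t * c) powr (s - 1) = exp (- c)"
      proof -
        have "- ?t * c * (s - 1) = - (?t * (s - 1)) * c" by algebra
        then have "- ?t * c * (s - 1) = - c" unfolding t(2) by simp
        then show ?thesis by (simp add: exp_powr_real)
      qed
      moreover have "(B powr (1 / \<eta>)) powr (s - 1) = (B powr (s - 1)) powr (1 / \<eta>)"
        by (simp add: powr_powr)
      moreover have "D * D powr (s - 1) = 2 powr (s / ?e)"
        unfolding D_def by (simp add: powr_powr powr_add[symmetric] diff_divide_distrib)
      ultimately have "exp c * (A powr (1 / \<eta>) * D) * (exp (- ?t * c) * (B powr (1 / \<eta>) * D)) powr (s - 1)
        = (exp c * exp (- c)) * (A powr (1 / \<eta>) * (B powr (s - 1)) powr (1 / \<eta>)) * 2 powr (s / ?e)"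
        using AB by (simp add: powr_mult D_def mult_ac)
      also have "\<dots> = (A * B powr (s - 1)) powr (1 / \<eta>) * 2 powr (s / ?e)"
        using AB by (simp add: powr_mult flip: exp_add)
      also have "\<dots> \<le> K powr (1 / \<eta>) * 2 powr (s / ?e)"
        using AB \<eta> by (intro mult_right_mono powr_mono2) auto
      finally show ?thesis .
    qed
    ultimately show ?thesis
      using AB by (intro exI conjI) (auto simp: D_def)
  qed
  have "AE x in lebesgue. 0 < u x * exp (\<beta> x)"
    using pos by eventually_elim (use u0 in \<open>auto simp: less_le\<close>)
  then show "(\<lambda>x. u x * exp (\<beta> x)) \<in> A_class s"
    "A_const s (\<lambda>x. u x * exp (\<beta> x)) \<le> ennreal (K powr (1 / \<eta>) * 2 powr (s / ?e))"
    using u0 s by (intro A_classI[OF _ _ _ s *]; force)+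
qed

lemma weight_measurable: "weight w \<Longrightarrow> w \<in> borel_measurable lebesgue"
  unfolding weight_def by (blast intro: locally_integrable_measurable)

lemma weight_mono:
  fixes v w :: "real^'n \<Rightarrow> real"
  assumes "weight w" and v: "v \<in> borel_measurable lebesgue" "\<And>x. 0 \<le> v x" and le: "\<And>x. v x \<le> w x"
  shows "weight v"
proof -
  have w: "w \<in> borel_measurable lebesgue" "\<And>x. 0 \<le> w x" "locally_integrable w"
    using assms(1) weight_measurable by (auto simp: weight_def)
  have "nn_average Q v < top" if "Q \<in> cubes" for Q
  proof -
    have "nn_average Q v \<le> nn_average Q w" by (intro nn_average_mono le)
    also have "\<dots> < top" using locally_integrable_iff_nn_average[OF w(1,2)] w(3) that by blast
    finally show ?thesis .
  qed
  then show ?thesis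
    using locally_integrable_iff_nn_average[OF v] v(2) by (auto simp: weight_def)
qed

section \<open>Perturbation of weights by exponentials of BMO functions\<close>

text \<open>The norm is finite and below 1 / \<tau>, so some \<lambda> < 1 / \<tau> is admissible in
  the infimum defining the exp L norm. The strict inequality makes it irrelevant whether the infimum
  is attained. The case \<tau> = 0 is separate because 1 / \<tau> is then 0 in HOL.\<close>

lemma BMO_exp_average_le:
  assumes b: "b \<in> BMO" and \<tau>: "0 \<le> \<tau>" "\<tau> * enn2real (bmo_norm b) < 1" and Q: "Q \<in> cubes"
  shows "nn_average Q (\<lambda>x. exp (\<tau> * norm (b x - average Q b))) \<le> 2"
proof (cases "\<tau> = 0")
  case True
  then show ?thesis using nn_average_const[OF Q, of 1] by simp
next
  case False
  have "expL_norm Q (\<lambda>x. b x - average Q b) \<le> bmo_norm b"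
    unfolding bmo_norm_def by (intro SUP_upper Q)
  also have "bmo_norm b = ennreal (enn2real (bmo_norm b))"
    using b by (simp add: BMO_def)
  also have "\<dots> < ennreal (1 / \<tau>)"
    using \<tau> False by (intro ennreal_lessI) (simp_all add: field_simps)
  finally obtain l where l: "0 < l" "nn_average Q (\<lambda>x. exp (norm (b x - average Q b) / l)) \<le> 2"
    "ennreal l < ennreal (1 / \<tau>)"
    unfolding expL_norm_def Inf_less_iff by blast
  have "l < 1 / \<tau>" using l by (simp add: ennreal_less_iff)
  then have "\<tau> * l \<le> 1" using \<tau> False by (simp add: field_simps)
  have "nn_average Q (\<lambda>x. exp (\<tau> * norm (b x - average Q b)))
      \<le> nn_average Q (\<lambda>x. exp (norm (b x - average Q b) / l))"
  proof (rule nn_average_mono)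
    fix x
    have "\<tau> * l * norm (b x - average Q b) \<le> 1 * norm (b x - average Q b)"
      using \<open>\<tau> * l \<le> 1\<close> by (intro mult_right_mono) auto
    then show "exp (\<tau> * norm (b x - average Q b)) \<le> exp (norm (b x - average Q b) / l)"
      using l by (simp add: field_simps)
  qed
  then show ?thesis using l(2) by (rule order_trans)
qed

text \<open>On a cube \<open>exp (\<beta> x)\<close> is at most \<open>exp c\<close> times an
  exponential of the oscillation of \<open>b\<close>, whose average is at most 2. This supplies
  local integrability for truncated weights multiplied by an exponential.\<close>

lemma BMO_exp_weight:
  fixes \<beta> :: "real^'n \<Rightarrow> real"
  assumes b: "b \<in> BMO" and \<rho>: "0 \<le> \<rho>" "\<rho> * enn2real (bmo_norm b) < 1" and "0 \<le> M"
    and \<beta>: "\<beta> \<in> borel_measurable lebesgue"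
    and osc: "\<And>Q. Q \<in> cubes \<Longrightarrow> \<exists>c. \<forall>x. \<bar>\<beta> x - c\<bar> \<le> \<rho> * norm (b x - average Q b)"
  shows "weight (\<lambda>x. M * exp (\<beta> x))"
proof -
  have m: "(\<lambda>x. M * exp (\<beta> x)) \<in> borel_measurable lebesgue"
    "b \<in> borel_measurable lebesgue"
    using \<beta> b by (auto simp: BMO_def intro: locally_integrable_measurable)
  have "nn_average Q (\<lambda>x. M * exp (\<beta> x)) < top" if Q: "Q \<in> cubes" for Q
  proof -
    obtain c where c: "\<And>x. \<bar>\<beta> x - c\<bar> \<le> \<rho> * norm (b x - average Q b)"
      using osc[OF Q] by blast
    have "nn_average Q (\<lambda>x. M * exp (\<beta> x))
        \<le> nn_average Q (\<lambda>x. (M * exp c) * exp (\<rho> * norm (b x - average Q b)))"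
    proof (rule nn_average_mono)
      fix x
      have "\<beta> x \<le> c + \<rho> * norm (b x - average Q b)" using c[of x] by linarith
      then have "exp (\<beta> x) \<le> exp c * exp (\<rho> * norm (b x - average Q b))"
        by (simp flip: exp_add)
      then have "M * exp (\<beta> x) \<le> M * (exp c * exp (\<rho> * norm (b x - average Q b)))"
        using \<open>0 \<le> M\<close> by (rule mult_left_mono)
      then show "M * exp (\<beta> x) \<le> (M * exp c) * exp (\<rho> * norm (b x - average Q b))"
        by (simp only: mult.assoc)
    qed
    also have "\<dots> = ennreal (M * exp c) * nn_average Q (\<lambda>x. exp (\<rho> * norm (b x - average Q b)))"
      using m \<open>0 \<le> M\<close> by (intro nn_average_cmult[OF Q]) auto
    also have "\<dots> \<le> ennreal (M * exp c) * 2"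
      by (intro mult_left_mono BMO_exp_average_le[OF b \<rho> Q]) auto
    also have "\<dots> < top" by (simp add: ennreal_mult_less_top)
    finally show ?thesis .
  qed
  then show ?thesis
    using locally_integrable_iff_nn_average[OF m(1)] \<open>0 \<le> M\<close> by (auto simp: weight_def)
qed

text \<open>The previous perturbation result for \<open>w powr \<theta>\<close> and \<theta> times
  \<beta>. The two smallness conditions on \<rho> correspond to its two oscillation averages. The
  hypothesis \<open>osc\<close> covers both exponents used later, -\<rho> times the modulus of
  \<open>b\<close> and -Re(zb).\<close>

lemma A_class_BMO_exp_mult:
  fixes w \<beta> :: "real^'n \<Rightarrow> real"
  assumes s: "1 < s" and \<eta>: "1 < \<eta>" and \<theta>: "0 < \<theta>"
    and w: "w \<in> borel_measurable lebesgue" "\<And>x. 0 \<le> w x"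
    and A: "(\<lambda>x. w x powr (\<theta> * \<eta>)) \<in> A_class s" "A_const s (\<lambda>x. w x powr (\<theta> * \<eta>)) \<le> ennreal K"
    and b: "b \<in> BMO" and \<rho>: "0 \<le> \<rho>"
      "\<rho> * (\<theta> * conj_exp \<eta>) * enn2real (bmo_norm b) < 1"
      "\<rho> * (\<theta> * conj_exp \<eta> * (conj_exp s - 1)) * enn2real (bmo_norm b) < 1"
    and \<beta>: "\<beta> \<in> borel_measurable lebesgue"
    and osc: "\<And>Q. Q \<in> cubes \<Longrightarrow> \<exists>c. \<forall>x. \<bar>\<beta> x - c\<bar> \<le> \<rho> * norm (b x - average Q b)"
  shows "(\<lambda>x. (w x * exp (\<beta> x)) powr \<theta>) \<in> A_class s"
    "A_const s (\<lambda>x. (w x * exp (\<beta> x)) powr \<theta>) \<le> ennreal (K powr (1 / \<eta>) * 2 powr (s / conj_exp \<eta>))"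
proof -
  have eq: "(\<lambda>x. (w x * exp (\<beta> x)) powr \<theta>) = (\<lambda>x. w x powr \<theta> * exp (\<theta> * \<beta> x))"
    using w by (simp add: powr_mult exp_powr_real mult.commute)
  have osc': "\<exists>c. nn_average Q (\<lambda>x. exp (conj_exp \<eta> * \<bar>\<theta> * \<beta> x - c\<bar>)) \<le> 2 \<and>
       nn_average Q (\<lambda>x. exp (conj_exp \<eta> * (conj_exp s - 1) * \<bar>\<theta> * \<beta> x - c\<bar>)) \<le> 2"
    if Q: "Q \<in> cubes" for Q
  proof -
    obtain c where c: "\<And>x. \<bar>\<beta> x - c\<bar> \<le> \<rho> * norm (b x - average Q b)"
      using osc[OF Q] by blast
    have le: "nn_average Q (\<lambda>x. exp (a * \<bar>\<theta> * \<beta> x - \<theta> * c\<bar>)) \<le> 2"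
      if "0 < a" "\<rho> * (\<theta> * a) * enn2real (bmo_norm b) < 1" for a
    proof -
      have "nn_average Q (\<lambda>x. exp (a * \<bar>\<theta> * \<beta> x - \<theta> * c\<bar>))
          \<le> nn_average Q (\<lambda>x. exp (\<rho> * (\<theta> * a) * norm (b x - average Q b)))"
      proof (rule nn_average_mono)
        fix x
        have "\<bar>\<theta> * \<beta> x - \<theta> * c\<bar> = \<theta> * \<bar>\<beta> x - c\<bar>"
          using \<theta> by (simp add: abs_mult flip: right_diff_distrib)
        moreover have "\<theta> * a * \<bar>\<beta> x - c\<bar> \<le> \<theta> * a * (\<rho> * norm (b x - average Q b))"
          using \<theta> \<open>0 < a\<close> by (intro mult_left_mono c) auto
        ultimately show "exp (a * \<bar>\<theta> * \<beta> x - \<theta> * c\<bar>) \<le> exp (\<rho> * (\<theta> * a) * norm (b x - average Q b))"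
          by (simp add: mult_ac)
      qed
      also have "\<dots> \<le> 2"
        using that \<theta> \<rho>(1) by (intro BMO_exp_average_le[OF b _ _ Q]) auto
      finally show ?thesis .
    qed
    show ?thesis
      using le[of "conj_exp \<eta>"] le[of "conj_exp \<eta> * (conj_exp s - 1)"] \<rho> conj_exp(1)[OF s] conj_exp(1)[OF \<eta>]
      by (intro exI[of _ "\<theta> * c"] conjI) (simp_all add: mult.assoc)
  qed
  have A': "(\<lambda>x. (w x powr \<theta>) powr \<eta>) \<in> A_class s" "A_const s (\<lambda>x. (w x powr \<theta>) powr \<eta>) \<le> ennreal K"
    using A by (simp_all add: powr_powr)
  show "(\<lambda>x. (w x * exp (\<beta> x)) powr \<theta>) \<in> A_class s"
    "A_const s (\<lambda>x. (w x * exp (\<beta> x)) powr \<theta>) \<le> ennreal (K powr (1 / \<eta>) * 2 powr (s / conj_exp \<eta>))"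
    unfolding eq by (rule A_class_exp_mult[OF s \<eta> _ _ A' _ osc']; use w \<beta> in simp)+
qed

section \<open>Power series\<close>

lemma power_div_fact_le_exp:
  fixes x :: real
  assumes "0 \<le> x"
  shows "x ^ n / fact n \<le> exp x"
proof -
  have "(\<Sum>i\<in>{n}. inverse (fact i) *\<^sub>R x ^ i) \<le> exp x"
    unfolding exp_def using assms by (intro sum_le_suminf summable_exp_generic) auto
  then show ?thesis by (simp add: divide_inverse_commute)
qed

text \<open>For indices \<open>m\<close> \<ge> \<open>n\<close> one has
  \<open>\<kappa> ^ m \<le> \<kappa> ^ n\<close>, so every term of the tail is at most
  \<open>\<kappa> ^ n\<close> times the corresponding term of the series of
  \<open>exp (norm y / \<kappa>)\<close>. Geometric decay of the remainder is thus bought with a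
  larger exponent.\<close>

lemma norm_exp_remainder_le:
  fixes y :: complex
  assumes "0 < \<kappa>" "\<kappa> \<le> 1"
  shows "norm (exp y - (\<Sum>j<n. y ^ j / fact j)) \<le> \<kappa> ^ n * exp (norm y / \<kappa>)"
proof -
  have s: "(\<lambda>j. y ^ j / fact j) sums exp y"
    using exp_converges[of y] by (simp add: scaleR_conv_of_real divide_inverse_commute)
  have t: "(\<lambda>j. norm y ^ j / \<kappa> ^ j / fact j) sums exp (norm y / \<kappa>)"
    using exp_converges[of "norm y / \<kappa>"] by (simp add: divide_inverse power_mult_distrib power_inverse mult_ac)
  then have t': "summable (\<lambda>j. norm y ^ (j + n) / \<kappa> ^ (j + n) / fact (j + n))"
    by (subst summable_iff_shift) (rule sums_summable)
  have le: "norm (y ^ (j + n) / fact (j + n)) \<le> \<kappa> ^ n * (norm y ^ (j + n) / \<kappa> ^ (j + n) / fact (j + n))" for j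
  proof -
    have "\<kappa> ^ (j + n) \<le> \<kappa> ^ n" using assms by (intro power_decreasing) auto
    then have "1 \<le> \<kappa> ^ n / \<kappa> ^ (j + n)" using assms by simp
    then have "1 * (norm y ^ (j + n) / fact (j + n)) \<le> \<kappa> ^ n / \<kappa> ^ (j + n) * (norm y ^ (j + n) / fact (j + n))"
      by (intro mult_right_mono) auto
    then show ?thesis by (simp add: norm_divide norm_power)
  qed
  have "exp y - (\<Sum>j<n. y ^ j / fact j) = (\<Sum>j. y ^ (j + n) / fact (j + n))"
    using suminf_split_initial_segment[OF sums_summable[OF s], of n] sums_unique[OF s] by simp
  also have "norm \<dots> \<le> (\<Sum>j. \<kappa> ^ n * (norm y ^ (j + n) / \<kappa> ^ (j + n) / fact (j + n)))"
    by (intro norm_suminf_le le summable_mult t')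
  also have "\<dots> = \<kappa> ^ n * (\<Sum>j. norm y ^ (j + n) / \<kappa> ^ (j + n) / fact (j + n))"
    by (intro suminf_mult t')
  also have "\<dots> \<le> \<kappa> ^ n * exp (norm y / \<kappa>)"
  proof (intro mult_left_mono)
    have "0 \<le> (\<Sum>j<n. norm y ^ j / \<kappa> ^ j / fact j)"
      using assms by (intro sum_nonneg) auto
    then show "(\<Sum>j. norm y ^ (j + n) / \<kappa> ^ (j + n) / fact (j + n)) \<le> exp (norm y / \<kappa>)"
      using suminf_split_initial_segment[OF sums_summable[OF t], of n] sums_unique[OF t] by simp
  qed (use assms in auto)
  finally show ?thesis .
qed

text \<open>Jensen's inequality for a finite mean. Young's inequality for \<open>x i\<close> and
  \<open>m powr (q - 1)\<close>, where \<open>m\<close> is the mean, is summed over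
  \<open>i\<close>; the terms containing \<open>m powr q\<close> are then collected on the left. No
  division by \<open>m\<close> occurs, so \<open>m\<close> = 0 is covered.\<close>

lemma powr_average_le:
  fixes x :: "'i \<Rightarrow> real"
  assumes q: "1 < q" and I: "finite I" "I \<noteq> {}" and x: "\<And>i. i \<in> I \<Longrightarrow> 0 \<le> x i"
  shows "((\<Sum>i\<in>I. x i) / card I) powr q \<le> (\<Sum>i\<in>I. x i powr q) / card I"
proof -
  define m where "m = (\<Sum>i\<in>I. x i) / card I"
  have card: "0 < card I" using I by (simp add: card_gt_0_iff)
  have m: "0 \<le> m" unfolding m_def using x by (intro divide_nonneg_nonneg sum_nonneg) auto
  define q' where "q' = q / (q - 1)"
  have q': "1 < q'" "1 / q + 1 / q' = 1" "(q - 1) * q' = q"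
    using q by (auto simp: q'_def field_simps)
  have "x i * m powr (q - 1) \<le> x i powr q / q + m powr q / q'" if "i \<in> I" for i
    using Youngs_inequality[OF q q'(1,2) x[OF that], of "m powr (q - 1)"] q' by (simp add: powr_powr)
  then have "(\<Sum>i\<in>I. x i * m powr (q - 1)) \<le> (\<Sum>i\<in>I. x i powr q / q + m powr q / q')"
    by (intro sum_mono)
  then have "(\<Sum>i\<in>I. x i) * m powr (q - 1) \<le> (\<Sum>i\<in>I. x i powr q) / q + card I * (m powr q / q')"
    by (simp add: sum_distrib_right sum_divide_distrib sum.distrib)
  moreover have "(\<Sum>i\<in>I. x i) * m powr (q - 1) = card I * m powr q"
  proof -
    have "m * m powr (q - 1) = m powr q"
      using m by (cases "m = 0") (simp_all add: powr_mult_base)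
    moreover have "(\<Sum>i\<in>I. x i) = card I * m" using card by (simp add: m_def)
    ultimately show ?thesis by simp
  qed
  ultimately have "card I * m powr q * (1 - 1 / q') \<le> (\<Sum>i\<in>I. x i powr q) / q"
    by (simp add: algebra_simps)
  moreover have "1 - 1 / q' = 1 / q" using q' by simp
  ultimately have "card I * m powr q \<le> (\<Sum>i\<in>I. x i powr q)"
    using q by (simp add: divide_le_cancel)
  then show ?thesis
    using card by (simp add: m_def[symmetric] field_simps)
qed

section \<open>Roots of unity and the extraction of Taylor coefficients\<close>

lemma cis_2pi_mult_eq_1_iff: "cis (2 * pi * x) = 1 \<longleftrightarrow> x \<in> \<int>"
proof
  assume "cis (2 * pi * x) = 1"
  then have "cos (2 * pi * x) = 1" by (simp add: complex_eq_iff)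
  then obtain n :: int where "2 * pi * x = n * 2 * pi"
    using cos_one_2pi_int by auto
  then have "x = n" by simp
  then show "x \<in> \<int>" by simp
qed (rule cis_multiple_2pi)

text \<open>A geometric sum with ratio \<omega>, where \<omega> is an \<open>N\<close>-th root of
  unity. It differs from 1 because the nonzero integer i - k is smaller than \<open>N\<close> in
  modulus.\<close>

lemma sum_roots_unity_orthogonal:
  fixes i k N :: nat
  assumes "i < N" "k < N" "i \<noteq> k"
  shows "(\<Sum>m<N. cnj (cis (2 * pi * m / N)) ^ k * cis (2 * pi * m / N) ^ i) = 0"
proof -
  define \<omega> where "\<omega> = cis (2 * pi * ((real i - real k) / N))"
  have "0 < N" using assms by simp
  have "(real i - real k) / N \<notin> \<int>"
  proof
    assume "(real i - real k) / N \<in> \<int>"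
    then obtain n :: int where "(real i - real k) / N = n" by (auto elim: Ints_cases)
    then have "real i - real k = n * real N" using \<open>0 < N\<close> by (simp add: field_simps)
    then have "int i - int k = n * int N"
      by (metis of_int_diff of_int_eq_iff of_int_mult of_int_of_nat_eq)
    moreover have "\<bar>int i - int k\<bar> < int N" using assms by auto
    ultimately have "int i - int k = 0"
      by (metis dvd_imp_le_int dvd_triv_right linorder_not_less abs_of_nat)
    then show False using assms by simp
  qed
  then have "\<omega> \<noteq> 1" unfolding \<omega>_def cis_2pi_mult_eq_1_iff .
  have "\<omega> ^ N = cis (2 * pi * of_int (int i - int k))"
    unfolding \<omega>_def Complex.DeMoivre using \<open>0 < N\<close> by (intro arg_cong[where f=cis]) simp
  also have "\<dots> = 1" by (intro cis_multiple_2pi) simp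
  finally have "\<omega> ^ N = 1" .
  have "(\<Sum>m<N. cnj (cis (2 * pi * m / N)) ^ k * cis (2 * pi * m / N) ^ i) = (\<Sum>m<N. \<omega> ^ m)"
  proof (intro sum.cong refl)
    fix m :: nat
    have "cnj (cis (2 * pi * m / N)) ^ k * cis (2 * pi * m / N) ^ i
        = cis (real k * - (2 * pi * m / N) + real i * (2 * pi * m / N))"
      unfolding cis_cnj Complex.DeMoivre cis_mult ..
    also have "real k * - (2 * pi * m / N) + real i * (2 * pi * m / N)
        = real m * (2 * pi * ((real i - real k) / N))"
      using \<open>0 < N\<close> by (simp add: field_simps)
    finally show "cnj (cis (2 * pi * m / N)) ^ k * cis (2 * pi * m / N) ^ i = \<omega> ^ m"
      unfolding \<omega>_def Complex.DeMoivre .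
  qed
  also have "\<dots> = 0"
    using geometric_sum[OF \<open>\<omega> \<noteq> 1\<close>, of N] \<open>\<omega> ^ N = 1\<close> by simp
  finally show ?thesis .
qed

text \<open>A discrete form of Cauchy's coefficient formula on the circle of radius
  \<open>r\<close>. For finite \<open>n\<close>, coefficients with indices congruent to
  \<open>k\<close> modulo \<open>Suc n\<close> also contribute; they disappear in the limit by
  Tannery's theorem, with dominating series \<open>norm (c i) * r ^ i\<close>.\<close>

lemma power_series_average_roots_unity:
  fixes c :: "nat \<Rightarrow> complex"
  assumes r: "0 \<le> r" and c: "summable (\<lambda>i. norm (c i) * r ^ i)"
  defines "\<zeta> \<equiv> \<lambda>n m. cis (2 * pi * real m / real (Suc n))"
  shows "(\<lambda>n. (\<Sum>m<Suc n. cnj (\<zeta> n m) ^ k * (\<Sum>i. c i * (of_real r * \<zeta> n m) ^ i)) / of_nat (Suc n))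
    \<longlonglongrightarrow> c k * of_real r ^ k"
proof -
  define E where "E = (\<lambda>i n. (\<Sum>m<Suc n. cnj (\<zeta> n m) ^ k * \<zeta> n m ^ i) / of_nat (Suc n))"
  define b where "b = (\<lambda>i. if i = k then c k * of_real r ^ k else 0)"
  have norm_\<zeta>: "norm (\<zeta> n m) = 1" for n m by (simp add: \<zeta>_def)
  have sm: "summable (\<lambda>i. c i * (of_real r * \<zeta> n m) ^ i)" for n m
    using c r by (intro summable_norm_cancel[of "\<lambda>i. c i * (of_real r * \<zeta> n m) ^ i"])
      (simp add: norm_mult norm_power norm_\<zeta>)
  have "norm (E i n) \<le> 1" for i n
  proof -
    have "norm (\<Sum>m<Suc n. cnj (\<zeta> n m) ^ k * \<zeta> n m ^ i) \<le> real (card {..<Suc n}) * 1"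
      by (intro sum_norm_bound) (simp add: norm_mult norm_power norm_\<zeta>)
    then show ?thesis by (simp add: E_def norm_divide del: sum.lessThan_Suc of_nat_Suc)
  qed
  then have "norm (c i * of_real r ^ i * E i n) \<le> norm (c i) * r ^ i" for i n
    using r mult_left_mono[of "norm (E i n)" 1 "norm (c i) * r ^ i"] by (simp add: norm_mult norm_power)
  then have bound: "\<forall>\<^sub>F (i, n) in sequentially \<times>\<^sub>F sequentially.
      norm (c i * of_real r ^ i * E i n) \<le> norm (c i) * r ^ i"
    by (intro always_eventually) auto
  have lim: "(\<lambda>n. c i * of_real r ^ i * E i n) \<longlonglongrightarrow> b i" for i
  \<comment> \<open>From this index on both \<open>i\<close> and \<open>k\<close> are below the
    number \<open>Suc n\<close> of roots, as orthogonality requires.\<close>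
  proof (rule tendsto_eventually, rule eventually_sequentiallyI[of "max i k"])
    fix n assume "max i k \<le> n"
    show "c i * of_real r ^ i * E i n = b i"
    proof (cases "i = k")
      case True
      have "cnj (\<zeta> n m) * \<zeta> n m = 1" for m
        using norm_\<zeta>[of n m] by (metis complex_norm_square mult.commute of_real_1 one_power2)
      then have "E k n = (\<Sum>m<Suc n. 1) / of_nat (Suc n)"
        unfolding E_def power_mult_distrib[symmetric] by simp
      also have "\<dots> = 1" by (simp del: sum.lessThan_Suc of_nat_Suc)
      finally show ?thesis using True by (simp add: b_def)
    next
      case False
      then have "E i n = 0"
        using \<open>max i k \<le> n\<close> sum_roots_unity_orthogonal[of i "Suc n" k] by (simp add: E_def \<zeta>_def del: sum.lessThan_Suc of_nat_Suc)
      with False show ?thesis by (simp add: b_def)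
    qed
  qed
  have "(\<lambda>n. \<Sum>i. c i * of_real r ^ i * E i n) \<longlonglongrightarrow> (\<Sum>i. b i)"
    using tannerys_theorem[OF lim bound c] by simp
  moreover have "(\<Sum>i. b i) = c k * of_real r ^ k"
    unfolding b_def using sums_single[of k "\<lambda>i. c k * of_real r ^ k"] by (simp add: sums_iff)
  moreover have "(\<Sum>i. c i * of_real r ^ i * E i n)
      = (\<Sum>m<Suc n. cnj (\<zeta> n m) ^ k * (\<Sum>i. c i * (of_real r * \<zeta> n m) ^ i)) / of_nat (Suc n)" for n
  proof -
    have "(\<Sum>i. c i * of_real r ^ i * E i n)
        = (\<Sum>i. (\<Sum>m<Suc n. cnj (\<zeta> n m) ^ k * (c i * (of_real r * \<zeta> n m) ^ i)) / of_nat (Suc n))"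
      by (intro suminf_cong) (simp add: E_def sum_distrib_left power_mult_distrib mult_ac del: sum.lessThan_Suc of_nat_Suc)
    also have "\<dots> = (\<Sum>i. \<Sum>m<Suc n. cnj (\<zeta> n m) ^ k * (c i * (of_real r * \<zeta> n m) ^ i)) / of_nat (Suc n)"
      by (intro suminf_divide summable_sum summable_mult sm)
    also have "\<dots> = (\<Sum>m<Suc n. \<Sum>i. cnj (\<zeta> n m) ^ k * (c i * (of_real r * \<zeta> n m) ^ i)) / of_nat (Suc n)"
      by (subst suminf_sum) (intro summable_mult sm refl)+
    also have "\<dots> = (\<Sum>m<Suc n. cnj (\<zeta> n m) ^ k * (\<Sum>i. c i * (of_real r * \<zeta> n m) ^ i)) / of_nat (Suc n)"
      by (intro arg_cong2[where f="(/)"] sum.cong refl suminf_mult sm)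
    finally show ?thesis .
  qed
  ultimately show ?thesis by simp
qed

text \<open>Pascal's rule. With \<open>y\<close> = \<open>- b x\<close> and \<open>g j\<close> the
  value at \<open>x\<close> of \<open>T\<close> applied to the \<open>j\<close>-th power of
  \<open>b\<close> times \<open>f\<close>, this is the recursion of the iterated commutator: the
  shift of \<open>g\<close> comes from replacing \<open>f\<close> by bf, the factor \<open>y\<close>
  from the subtracted term.\<close>

lemma binomial_recurrence_sum:
  fixes g :: "nat \<Rightarrow> 'a::comm_ring_1"
  shows "(\<Sum>j\<le>Suc k. of_nat (Suc k choose j) * y ^ (Suc k - j) * g j) =
    (\<Sum>j\<le>k. of_nat (k choose j) * y ^ (k - j) * g (Suc j)) +
    y * (\<Sum>j\<le>k. of_nat (k choose j) * y ^ (k - j) * g j)"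
proof -
  \<comment> \<open>The sum may be extended to \<open>Suc k\<close> because
    \<open>k choose Suc k\<close> is 0.\<close>
  have "y * (\<Sum>j\<le>k. of_nat (k choose j) * y ^ (k - j) * g j)
      = (\<Sum>j\<le>Suc k. of_nat (k choose j) * y ^ (Suc k - j) * g j)"
    by (simp add: sum_distrib_left Suc_diff_le mult_ac binomial_eq_0)
  also have "\<dots> = y ^ Suc k * g 0 + (\<Sum>j\<le>k. of_nat (k choose Suc j) * y ^ (k - j) * g (Suc j))"
    by (simp only: sum.atMost_Suc_shift) simp
  finally show ?thesis
    by (simp only: sum.atMost_Suc_shift)
      (simp add: sum.distrib[symmetric] distrib_right of_nat_add add_ac)
qed

text \<open>The induction is over all \<open>f\<close> at once, since the recursion evaluates the
  previous commutator at bf. The expansion holds at every point, so no null sets enter.\<close>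

lemma iterated_commutator_eq_sum:
  "iterated_commutator T b k f x =
    (\<Sum>j\<le>k. of_nat (k choose j) * (- b x) ^ (k - j) * T (\<lambda>y. b y ^ j * f y) x)"
proof (induction k arbitrary: f)
  case (Suc k)
  have "(\<lambda>y. b y ^ j * (b y * f y)) = (\<lambda>y. b y ^ Suc j * f y)" for j
    by (simp add: mult_ac)
  then show ?case
    unfolding binomial_recurrence_sum by (simp only: iterated_commutator.simps commutator_def Suc.IH) simp
qed simp

text \<open>The integrals have a finite sum, so the series of integrands converges almost
  everywhere. Its terms tend to 0, and the factor \<open>u x\<close> can be divided out where it is
  positive.\<close>

lemma AE_tendsto_zero_of_geometric:
  fixes h :: "nat \<Rightarrow> 'a \<Rightarrow> complex"
  assumes [measurable]: "\<And>n. h n \<in> borel_measurable M" "u \<in> borel_measurable M"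
    and u: "\<And>x. 0 \<le> u x" "AE x in M. 0 < u x" and q: "0 < q" and \<kappa>: "0 \<le> \<kappa>" "\<kappa> < 1" and "0 \<le> A"
    and bound: "\<And>n. (\<integral>\<^sup>+x. ennreal (norm (h n x) powr q * u x) \<partial>M) \<le> ennreal (A * \<kappa> ^ n)"
  shows "AE x in M. (\<lambda>n. h n x) \<longlonglongrightarrow> 0"
proof -
  have "(\<integral>\<^sup>+x. (\<Sum>n. ennreal (norm (h n x) powr q * u x)) \<partial>M)
      = (\<Sum>n. \<integral>\<^sup>+x. ennreal (norm (h n x) powr q * u x) \<partial>M)"
    by (intro nn_integral_suminf) measurable
  also have "\<dots> \<le> (\<Sum>n. ennreal (A * \<kappa> ^ n))"
    by (intro suminf_le bound) auto
  also have "\<dots> = ennreal (\<Sum>n. A * \<kappa> ^ n)"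
    using \<open>0 \<le> A\<close> \<kappa> by (intro suminf_ennreal2 summable_mult summable_geometric) auto
  also have "\<dots> < top" by simp
  finally have "AE x in M. (\<Sum>n. ennreal (norm (h n x) powr q * u x)) \<noteq> \<infinity>"
    by (intro nn_integral_PInf_AE) auto
  with u(2) show ?thesis
  proof eventually_elim
    case (elim x)
    then have "summable (\<lambda>n. norm (h n x) powr q * u x)"
      using u(1) by (intro summable_suminf_not_top) auto
    then have "(\<lambda>n. norm (h n x) powr q * u x / u x) \<longlonglongrightarrow> 0 / u x"
      using elim by (intro tendsto_divide summable_LIMSEQ_zero tendsto_const) auto
    then have "(\<lambda>n. norm (h n x) powr q) \<longlonglongrightarrow> 0"
      using elim by simp
    then have "(\<lambda>n. (norm (h n x) powr q) powr (1 / q)) \<longlonglongrightarrow> 0 powr (1 / q)"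
      using q by (intro tendsto_powr') auto
    then have "(\<lambda>n. norm (h n x)) \<longlonglongrightarrow> 0"
      using q by (simp add: powr_powr)
    then show ?case by (simp only: tendsto_norm_zero_iff)
  qed
qed

text \<open>The numbers \<open>c n\<close> are the coefficients of the Cauchy product of the series
  of exp(-z\<beta>) with the series of the \<open>a j\<close>.\<close>

lemma Cauchy_product_exp:
  fixes a :: "nat \<Rightarrow> complex" and \<beta> z :: complex and r :: real
  assumes a: "summable (\<lambda>j. norm (a j) * r ^ j)" and "0 \<le> r"
  defines "c \<equiv> \<lambda>n. \<Sum>j\<le>n. (- \<beta>) ^ (n - j) / fact (n - j) * a j"
  shows "summable (\<lambda>n. norm (c n) * r ^ n)"
    and "norm z = r \<Longrightarrow> (\<Sum>n. c n * z ^ n) = exp (- (z * \<beta>)) * (\<Sum>j. a j * z ^ j)"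
proof -
  have conv: "(\<lambda>n. \<Sum>j\<le>n. a j * z ^ j * ((- (z * \<beta>)) ^ (n - j) / fact (n - j))) = (\<lambda>n. c n * z ^ n)" for z
  proof
    fix n
    have "z ^ j * (- (z * \<beta>)) ^ (n - j) = (- \<beta>) ^ (n - j) * z ^ n" if "j \<le> n" for j
    proof -
      have "z ^ j * (- (z * \<beta>)) ^ (n - j) = (- \<beta>) ^ (n - j) * (z ^ j * z ^ (n - j))"
        unfolding mult_minus_right[symmetric] power_mult_distrib by (simp only: mult_ac)
      with that show ?thesis by (simp flip: power_add)
    qed
    then have "a j * z ^ j * ((- (z * \<beta>)) ^ (n - j) / fact (n - j))
        = (- \<beta>) ^ (n - j) / fact (n - j) * a j * z ^ n" if "j \<le> n" for j
      using that by (simp add: mult.assoc)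
    then show "(\<Sum>j\<le>n. a j * z ^ j * ((- (z * \<beta>)) ^ (n - j) / fact (n - j))) = c n * z ^ n"
      unfolding c_def sum_distrib_right by (intro sum.cong refl) simp
  qed
  have sums: "(\<lambda>n. c n * z ^ n) sums ((\<Sum>j. a j * z ^ j) * exp (- (z * \<beta>)))" if "norm z = r" for z
  proof -
    have e: "(- (z * \<beta>)) ^ i / fact i = (- (z * \<beta>)) ^ i /\<^sub>R fact i" for i
      by (simp add: scaleR_conv_of_real divide_inverse_commute)
    have "summable (\<lambda>i. norm ((- (z * \<beta>)) ^ i / fact i))"
      unfolding e by (rule summable_norm_exp)
    moreover have "summable (\<lambda>j. norm (a j * z ^ j))"
      using a that by (simp add: norm_mult norm_power)
    ultimately have "(\<lambda>n. c n * z ^ n) sums ((\<Sum>j. a j * z ^ j) * (\<Sum>i. (- (z * \<beta>)) ^ i / fact i))"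
      using Cauchy_product_sums[of "\<lambda>j. a j * z ^ j" "\<lambda>i. (- (z * \<beta>)) ^ i / fact i"] by (simp only: conv)
    then show ?thesis by (simp only: e exp_def)
  qed
  then show "norm z = r \<Longrightarrow> (\<Sum>n. c n * z ^ n) = exp (- (z * \<beta>)) * (\<Sum>j. a j * z ^ j)"
    by (simp add: sums_unique[OF sums, symmetric] mult.commute)
  \<comment> \<open>Absolute summability needs just one point of the circle, and the Cauchy product
    of the norms dominates there.\<close>
  define z :: complex where "z = of_real r"
  have z: "norm z = r" using \<open>0 \<le> r\<close> by (simp add: z_def)
  have "(- (z * \<beta>)) ^ i / fact i = (- (z * \<beta>)) ^ i /\<^sub>R fact i" for i
    by (simp add: scaleR_conv_of_real divide_inverse_commute)
  then have "summable (\<lambda>i. norm ((- (z * \<beta>)) ^ i / fact i))"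
    using summable_norm_exp[of "- (z * \<beta>)"] by (simp only:)
  moreover have "summable (\<lambda>j. norm (a j * z ^ j))"
    using a z by (simp add: norm_mult norm_power)
  ultimately have sm: "summable (\<lambda>n. \<Sum>j\<le>n. norm (a j * z ^ j) * norm ((- (z * \<beta>)) ^ (n - j) / fact (n - j)))"
    by (intro summable_Cauchy_product) simp_all
  have "summable (\<lambda>n. norm (c n * z ^ n))"
  proof (rule summable_comparison_test'[OF sm, where N=0])
    fix n
    have "c n * z ^ n = (\<Sum>j\<le>n. a j * z ^ j * ((- (z * \<beta>)) ^ (n - j) / fact (n - j)))"
      using fun_cong[OF conv[of z], of n] by (rule sym)
    also have "norm \<dots> \<le> (\<Sum>j\<le>n. norm (a j * z ^ j) * norm ((- (z * \<beta>)) ^ (n - j) / fact (n - j)))"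
      by (intro sum_norm_le norm_mult_ineq)
    finally show "norm (norm (c n * z ^ n)) \<le> \<dots>" by simp
  qed
  then show "summable (\<lambda>n. norm (c n) * r ^ n)"
    by (simp add: norm_mult norm_power z)
qed

section \<open>Commutators as Taylor coefficients\<close>

lemma Lp_norm_le_iff:
  assumes "0 < p" "0 \<le> c"
  shows "Lp_norm p u f \<le> ennreal c \<longleftrightarrow>
    (\<integral>\<^sup>+x. ennreal (norm (f x) powr p * u x) \<partial>lebesgue) \<le> ennreal (c powr p)"
proof (cases "\<integral>\<^sup>+x. ennreal (norm (f x) powr p * u x) \<partial>lebesgue")
  case (real t)
  have "t powr (1 / p) \<le> c \<longleftrightarrow> t \<le> c powr p"
  proof
    assume "t powr (1 / p) \<le> c"
    then have "(t powr (1 / p)) powr p \<le> c powr p" using assms by (intro powr_mono2) auto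
    then show "t \<le> c powr p" using real assms by (simp add: powr_powr)
  next
    assume "t \<le> c powr p"
    then have "t powr (1 / p) \<le> (c powr p) powr (1 / p)" using assms real by (intro powr_mono2) auto
    then show "t powr (1 / p) \<le> c" using assms by (simp add: powr_powr)
  qed
  then show ?thesis using real assms by (simp add: Lp_norm_def enn_powr_ennreal)
next
  case top
  then show ?thesis by (simp add: Lp_norm_def enn_powr_def top_unique)
qed

lemma Lp_dominated:
  fixes f g :: "real^'n \<Rightarrow> complex" and v w :: "real^'n \<Rightarrow> real"
  assumes [measurable]: "g \<in> borel_measurable lebesgue" "w \<in> borel_measurable lebesgue"
    and f: "f \<in> Lp p (\<lambda>x. w x powr p)" "Lp_norm p (\<lambda>x. w x powr p) f \<le> ennreal N"
    and "0 < p" "0 \<le> N" "0 \<le> \<kappa>" and v: "\<And>x. 0 \<le> v x" and w: "\<And>x. 0 \<le> w x"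
    and le: "\<And>x. norm (g x) * v x \<le> \<kappa> * (norm (f x) * w x)"
  shows "g \<in> Lp p (\<lambda>x. v x powr p)" "Lp_norm p (\<lambda>x. v x powr p) g \<le> ennreal (\<kappa> * N)"
proof -
  have [measurable]: "f \<in> borel_measurable lebesgue" using f by (simp add: Lp_def)
  have "norm (g x) powr p * v x powr p \<le> \<kappa> powr p * (norm (f x) powr p * w x powr p)" for x
  proof -
    have "(norm (g x) * v x) powr p \<le> (\<kappa> * (norm (f x) * w x)) powr p"
      using le[of x] v[of x] \<open>0 < p\<close> by (intro powr_mono2) auto
    then show ?thesis using v[of x] w[of x] \<open>0 \<le> \<kappa>\<close> by (simp add: powr_mult)
  qed
  then have "(\<integral>\<^sup>+x. ennreal (norm (g x) powr p * v x powr p) \<partial>lebesgue)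
      \<le> (\<integral>\<^sup>+x. ennreal (\<kappa> powr p) * ennreal (norm (f x) powr p * w x powr p) \<partial>lebesgue)"
    by (intro nn_integral_mono) (simp add: ennreal_mult'[symmetric] ennreal_leI)
  also have "\<dots> = ennreal (\<kappa> powr p) * (\<integral>\<^sup>+x. ennreal (norm (f x) powr p * w x powr p) \<partial>lebesgue)"
    by (intro nn_integral_cmult) measurable
  also have "\<dots> \<le> ennreal (\<kappa> powr p) * ennreal (N powr p)"
    using f(2) \<open>0 < p\<close> \<open>0 \<le> N\<close> by (intro mult_left_mono) (simp_all add: Lp_norm_le_iff)
  also have "\<dots> = ennreal ((\<kappa> * N) powr p)"
    using \<open>0 \<le> \<kappa>\<close> \<open>0 \<le> N\<close> by (simp add: powr_mult ennreal_mult'[symmetric])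
  finally show le: "Lp_norm p (\<lambda>x. v x powr p) g \<le> ennreal (\<kappa> * N)"
    using \<open>0 < p\<close> \<open>0 \<le> \<kappa>\<close> \<open>0 \<le> N\<close> by (simp add: Lp_norm_le_iff)
  show "g \<in> Lp p (\<lambda>x. v x powr p)"
    using le_less_trans[OF le ennreal_less_top] by (simp add: Lp_def)
qed

lemma linear_operator_on_diff:
  assumes "linear_operator_on D T" "f \<in> D" "g \<in> D"
  shows "AE x in lebesgue. T (\<lambda>y. f y - c * g y) x = T f x - c * T g x"
proof -
  have "AE x in lebesgue. T (\<lambda>y. 1 * f y + - c * g y) x = 1 * T f x + - c * T g x"
    using assms unfolding linear_operator_on_def by blast
  then show ?thesis by simp
qed

text \<open>The weight \<open>v \<rho>\<close> absorbs powers and exponentials of \<open>b\<close>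
  up to rate \<rho>, so \<open>T\<close> can be applied to every term and every Taylor remainder.
  Only finite linearity is used, in telescoping form; the passage to infinite sums comes from
  geometric decay of the images of the remainders.\<close>

lemma exp_series_operator:
  fixes T :: "(real^'n \<Rightarrow> complex) \<Rightarrow> (real^'n \<Rightarrow> complex)"
    and b f :: "real^'n \<Rightarrow> complex" and w :: "real^'n \<Rightarrow> real"
  defines "v \<equiv> \<lambda>\<rho> x. w x * exp (- \<rho> * norm (b x))"
  assumes p: "1 < p" and q: "1 < q" and lin: "linear_operator_on D T"
    and [measurable]: "w \<in> borel_measurable lebesgue" "b \<in> borel_measurable lebesgue"
    and w: "\<And>x. 0 \<le> w x" "AE x in lebesgue. 0 < w x"
    and r: "0 < r" "r < \<rho>" and \<Phi>: "0 \<le> \<Phi>"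
    and T: "\<And>g. g \<in> Lp p (\<lambda>x. v \<rho> x powr p) \<Longrightarrow> g \<in> D \<and> T g \<in> Lp q (\<lambda>x. v \<rho> x powr q) \<and>
      Lp_norm q (\<lambda>x. v \<rho> x powr q) (T g) \<le> ennreal \<Phi> * Lp_norm p (\<lambda>x. v \<rho> x powr p) g"
    and f: "f \<in> Lp p (\<lambda>x. w x powr p)"
  shows "T (\<lambda>y. b y ^ j * f y) \<in> borel_measurable lebesgue"
    and "AE x in lebesgue. summable (\<lambda>j. norm (T (\<lambda>y. b y ^ j * f y) x / fact j) * r ^ j)"
    and "norm z = r \<Longrightarrow> AE x in lebesgue.
      (\<lambda>j. T (\<lambda>y. b y ^ j * f y) x / fact j * z ^ j) sums T (\<lambda>y. exp (z * b y) * f y) x"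
proof -
  have [measurable]: "f \<in> borel_measurable lebesgue" using f by (simp add: Lp_def)
  have v0: "0 \<le> v \<rho> x" for x using w by (simp add: v_def)
  have v_pos: "AE x in lebesgue. 0 < v \<rho> x powr q"
    using w(2) by eventually_elim (simp add: v_def)
  have [measurable]: "v \<rho> \<in> borel_measurable lebesgue" unfolding v_def by measurable
  obtain N where N: "Lp_norm p (\<lambda>x. w x powr p) f = ennreal N" "0 \<le> N"
    using f by (cases "Lp_norm p (\<lambda>x. w x powr p) f") (auto simp: Lp_def)
  have dom: "g \<in> D \<and> T g \<in> borel_measurable lebesgue \<and>
      (\<integral>\<^sup>+x. ennreal (norm (T g x) powr q * v \<rho> x powr q) \<partial>lebesgue) \<le> ennreal ((\<Phi> * (\<kappa> * N)) powr q) \<and>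
      g \<in> Lp p (\<lambda>x. v \<rho> x powr p)"
    if [measurable]: "g \<in> borel_measurable lebesgue" and "0 \<le> \<kappa>"
      and "\<And>x. norm (g x) * v \<rho> x \<le> \<kappa> * (norm (f x) * w x)" for g \<kappa>
  proof -
    have g: "g \<in> Lp p (\<lambda>x. v \<rho> x powr p)" "Lp_norm p (\<lambda>x. v \<rho> x powr p) g \<le> ennreal (\<kappa> * N)"
      by (rule Lp_dominated[OF _ _ f eq_refl[OF N(1)], where \<kappa>=\<kappa>]; use p N that w v0 in simp)+
    have "Lp_norm q (\<lambda>x. v \<rho> x powr q) (T g) \<le> ennreal \<Phi> * Lp_norm p (\<lambda>x. v \<rho> x powr p) g"
      using T[OF g(1)] by blast
    also have "\<dots> \<le> ennreal \<Phi> * ennreal (\<kappa> * N)" by (intro mult_left_mono g) auto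
    also have "\<dots> = ennreal (\<Phi> * (\<kappa> * N))" using \<Phi> by (simp add: ennreal_mult')
    finally show ?thesis
      using T[OF g(1)] g(1) q \<Phi> N \<open>0 \<le> \<kappa>\<close> by (auto simp: Lp_norm_le_iff Lp_def)
  qed
  have \<rho>: "0 < \<rho>" using r by simp
  define B where "B = (\<lambda>j y. b y ^ j * f y)"
  have B: "B j \<in> D \<and> T (B j) \<in> borel_measurable lebesgue \<and>
      (\<integral>\<^sup>+x. ennreal (norm (T (B j) x) powr q * v \<rho> x powr q) \<partial>lebesgue)
        \<le> ennreal ((\<Phi> * (fact j / \<rho> ^ j * N)) powr q) \<and> B j \<in> Lp p (\<lambda>x. v \<rho> x powr p)" for j
  proof (rule dom)
    show "norm (B j x) * v \<rho> x \<le> fact j / \<rho> ^ j * (norm (f x) * w x)" for x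
    proof -
      have "(\<rho> * norm (b x)) ^ j / fact j \<le> exp (\<rho> * norm (b x))"
        using \<rho> by (intro power_div_fact_le_exp) auto
      then have "norm (b x) ^ j * exp (- \<rho> * norm (b x)) \<le> fact j / \<rho> ^ j"
        using \<rho> by (simp add: exp_minus field_simps power_mult_distrib)
      then have "norm (b x) ^ j * exp (- \<rho> * norm (b x)) * (norm (f x) * w x) \<le> fact j / \<rho> ^ j * (norm (f x) * w x)"
        using w by (intro mult_right_mono) auto
      then show ?thesis by (simp add: B_def v_def norm_mult norm_power mult_ac)
    qed
  qed (use \<rho> in \<open>auto simp: B_def\<close>)
  have [measurable]: "T (B j) \<in> borel_measurable lebesgue" for j using B by blast
  then show "T (\<lambda>y. b y ^ j * f y) \<in> borel_measurable lebesgue" by (simp add: B_def)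
  define a where "a = (\<lambda>j x. T (B j) x / fact j)"
  show "AE x in lebesgue. summable (\<lambda>j. norm (T (\<lambda>y. b y ^ j * f y) x / fact j) * r ^ j)"
  proof -
    \<comment> \<open>A radius strictly between \<open>r\<close> and \<rho>: the terms at
      \<open>r'\<close> decay geometrically in norm, hence are bounded almost everywhere, and
      comparison with powers of r / r' gives absolute summability at \<open>r\<close>.\<close>
    define r' where "r' = (r + \<rho>) / 2"
    have r': "r < r'" "r' < \<rho>" "0 < r'" using r by (auto simp: r'_def)
    have "AE x in lebesgue. (\<lambda>n. a n x * of_real r' ^ n) \<longlonglongrightarrow> 0"
    proof (rule AE_tendsto_zero_of_geometric)
      show "(\<integral>\<^sup>+x. ennreal (norm (a n x * of_real r' ^ n) powr q * v \<rho> x powr q) \<partial>lebesgue)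
          \<le> ennreal ((\<Phi> * N) powr q * ((r' / \<rho>) powr q) ^ n)" for n
      proof -
        have "(\<integral>\<^sup>+x. ennreal (norm (a n x * of_real r' ^ n) powr q * v \<rho> x powr q) \<partial>lebesgue)
          = (\<integral>\<^sup>+x. ennreal ((r' ^ n / fact n) powr q) * ennreal (norm (T (B n) x) powr q * v \<rho> x powr q) \<partial>lebesgue)"
          using r' by (intro nn_integral_cong)
            (simp add: a_def norm_mult norm_divide norm_power powr_mult powr_divide ennreal_mult'[symmetric] mult_ac)
        also have "\<dots> = ennreal ((r' ^ n / fact n) powr q) * (\<integral>\<^sup>+x. ennreal (norm (T (B n) x) powr q * v \<rho> x powr q) \<partial>lebesgue)"
          by (intro nn_integral_cmult) measurable
        also have "\<dots> \<le> ennreal ((r' ^ n / fact n) powr q) * ennreal ((\<Phi> * (fact n / \<rho> ^ n * N)) powr q)"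
          using B by (intro mult_left_mono) auto
        also have "\<dots> = ennreal ((r' ^ n / fact n * (\<Phi> * (fact n / \<rho> ^ n * N))) powr q)"
          using r' \<Phi> N \<rho> by (subst powr_mult) (auto simp: ennreal_mult')
        also have "r' ^ n / fact n * (\<Phi> * (fact n / \<rho> ^ n * N)) = \<Phi> * N * (r' / \<rho>) ^ n"
          by (simp add: power_divide)
        also have "(\<Phi> * N * (r' / \<rho>) ^ n) powr q = (\<Phi> * N) powr q * ((r' / \<rho>) powr q) ^ n"
          using r' \<Phi> N \<rho> by (simp add: powr_mult powr_power powr_powr mult.commute flip: powr_realpow)
        finally show ?thesis .
      qed
      show "(r' / \<rho>) powr q < 1"
        using r' q powr_less_mono2[of q "r' / \<rho>" 1] by simp
    qed (use v_pos q in \<open>auto simp: a_def\<close>)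
    then have "AE x in lebesgue. summable (\<lambda>j. norm (a j x) * r ^ j)"
    proof eventually_elim
      case (elim x)
      then have "Bseq (\<lambda>n. a n x * of_real r' ^ n)"
        by (intro convergent_imp_Bseq) (auto simp: convergent_def)
      then obtain K where K: "\<And>n. norm (a n x * of_real r' ^ n) \<le> K" unfolding Bseq_def by blast
      show ?case
      proof (rule summable_comparison_test'[where N=0])
        show "summable (\<lambda>n. K * (r / r') ^ n)"
          using r r' by (intro summable_mult summable_geometric) auto
        fix n
        have "norm (a n x) * r' ^ n * (r / r') ^ n \<le> K * (r / r') ^ n"
          using K[of n] r r' by (intro mult_right_mono) (auto simp: norm_mult norm_power)
        then show "norm (norm (a n x) * r ^ n) \<le> K * (r / r') ^ n"
          using r r' by (simp add: power_divide)
      qed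
    qed
    then show ?thesis by (simp add: a_def B_def)
  qed
  assume z: "norm z = r"
  \<comment> \<open>The \<open>J\<close>-th remainder of the Taylor series of exp(zb)f, which for
    \<open>J\<close> = 0 is the function itself. The remainder estimate with \<kappa> = r / \<rho>
    produces exactly the exponential that \<open>v \<rho>\<close> cancels.\<close>
  define R where "R = (\<lambda>J y. (exp (z * b y) - (\<Sum>j<J. (z * b y) ^ j / fact j)) * f y)"
  have R: "R J \<in> D \<and> T (R J) \<in> borel_measurable lebesgue \<and>
      (\<integral>\<^sup>+x. ennreal (norm (T (R J) x) powr q * v \<rho> x powr q) \<partial>lebesgue)
        \<le> ennreal ((\<Phi> * ((r / \<rho>) ^ J * N)) powr q) \<and> R J \<in> Lp p (\<lambda>x. v \<rho> x powr p)" for J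
  proof (rule dom)
    show "norm (R J x) * v \<rho> x \<le> (r / \<rho>) ^ J * (norm (f x) * w x)" for x
    proof -
      have "norm (exp (z * b x) - (\<Sum>j<J. (z * b x) ^ j / fact j))
          \<le> (r / \<rho>) ^ J * exp (norm (z * b x) / (r / \<rho>))"
        using r by (intro norm_exp_remainder_le) auto
      also have "norm (z * b x) / (r / \<rho>) = \<rho> * norm (b x)"
        using r z by (simp add: norm_mult)
      finally have "norm (exp (z * b x) - (\<Sum>j<J. (z * b x) ^ j / fact j)) * (norm (f x) * v \<rho> x)
          \<le> (r / \<rho>) ^ J * exp (\<rho> * norm (b x)) * (norm (f x) * v \<rho> x)"
        using v0 by (intro mult_right_mono) auto
      also have "\<dots> = (r / \<rho>) ^ J * (norm (f x) * w x)"
        by (simp add: v_def exp_minus)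
      finally show ?thesis by (simp add: R_def norm_mult mult_ac)
    qed
    show "R J \<in> borel_measurable lebesgue" unfolding R_def by measurable
  qed (use r in auto)
  have [measurable]: "T (R J) \<in> borel_measurable lebesgue" for J using R by blast
  have lim: "AE x in lebesgue. (\<lambda>J. T (R J) x) \<longlonglongrightarrow> 0"
  proof (rule AE_tendsto_zero_of_geometric)
    show "(\<integral>\<^sup>+x. ennreal (norm (T (R n) x) powr q * v \<rho> x powr q) \<partial>lebesgue)
        \<le> ennreal ((\<Phi> * N) powr q * ((r / \<rho>) powr q) ^ n)" for n
    proof -
      have "(\<Phi> * ((r / \<rho>) ^ n * N)) powr q = (\<Phi> * N) powr q * ((r / \<rho>) powr q) ^ n"
        using r \<Phi> N \<rho> by (simp add: powr_mult powr_power powr_powr mult_ac flip: powr_realpow)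
      then show ?thesis using R[of n] by simp
    qed
    show "(r / \<rho>) powr q < 1"
      using r q powr_less_mono2[of q "r / \<rho>" 1] by simp
  qed (use v_pos q in auto)
  \<comment> \<open>Each \<open>J\<close> has its own null set; their countable union is still null,
    so the partial sums telescope at almost every point.\<close>
  have step: "AE x in lebesgue. \<forall>J. T (R (Suc J)) x = T (R J) x - z ^ J / fact J * T (B J) x"
  proof (subst AE_all_countable, rule allI)
    fix J
    have eq: "R (Suc J) = (\<lambda>y. R J y - z ^ J / fact J * B J y)"
      by (simp add: R_def B_def fun_eq_iff algebra_simps power_mult_distrib)
    show "AE x in lebesgue. T (R (Suc J)) x = T (R J) x - z ^ J / fact J * T (B J) x"
      unfolding eq using R B by (intro linear_operator_on_diff[OF lin]) blast+
  qed
  have R0: "R 0 = (\<lambda>y. exp (z * b y) * f y)" by (simp add: R_def)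
  from lim step show "AE x in lebesgue.
      (\<lambda>j. T (\<lambda>y. b y ^ j * f y) x / fact j * z ^ j) sums T (\<lambda>y. exp (z * b y) * f y) x"
  proof eventually_elim
    case (elim x)
    have sum: "(\<Sum>j<J. a j x * z ^ j) = T (R 0) x - T (R J) x" for J
      by (induction J) (use elim in \<open>auto simp: a_def\<close>)
    have "(\<lambda>J. T (R 0) x - T (R J) x) \<longlonglongrightarrow> T (R 0) x - 0"
      using elim by (intro tendsto_diff tendsto_const)
    then have "(\<lambda>j. a j x * z ^ j) sums T (R 0) x"
      unfolding sums_def sum by simp
    then show ?case unfolding R0 by (simp add: a_def B_def)
  qed
qed

text \<open>The two hypotheses on \<open>T\<close> have different roles: \<open>T\<^sub>0\<close>,
  for the single weight \<open>v \<rho>\<close>, justifies the Taylor expansion, and its constant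
  leaves no trace in the result; \<open>T\<close>, for the weights \<open>u n z\<close>, gives the
  uniform bound on the circle that enters Cauchy's estimate.\<close>

lemma iterated_commutator_bound:
  fixes T :: "(real^'n \<Rightarrow> complex) \<Rightarrow> (real^'n \<Rightarrow> complex)"
    and b f :: "real^'n \<Rightarrow> complex" and w :: "real^'n \<Rightarrow> real"
  defines "v \<equiv> \<lambda>\<rho> x. w x * exp (- \<rho> * norm (b x))"
    and "u \<equiv> \<lambda>n z x. min (w x) (real (Suc n)) * exp (- Re (z * b x))"
  assumes p: "1 < p" and q: "1 < q" and lin: "linear_operator_on D T"
    and [measurable]: "w \<in> borel_measurable lebesgue" "b \<in> borel_measurable lebesgue"
    and w: "\<And>x. 0 \<le> w x" "AE x in lebesgue. 0 < w x"
    and r: "0 < r" "r < \<rho>" and \<Phi>: "0 \<le> \<Phi>\<^sub>0" "0 \<le> \<Phi>"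
    and T\<^sub>0: "\<And>g. g \<in> Lp p (\<lambda>x. v \<rho> x powr p) \<Longrightarrow> g \<in> D \<and> T g \<in> Lp q (\<lambda>x. v \<rho> x powr q) \<and>
      Lp_norm q (\<lambda>x. v \<rho> x powr q) (T g) \<le> ennreal \<Phi>\<^sub>0 * Lp_norm p (\<lambda>x. v \<rho> x powr p) g"
    and T: "\<And>n z g. norm z = r \<Longrightarrow> g \<in> Lp p (\<lambda>x. u n z x powr p) \<Longrightarrow>
      T g \<in> Lp q (\<lambda>x. u n z x powr q) \<and>
      Lp_norm q (\<lambda>x. u n z x powr q) (T g) \<le> ennreal \<Phi> * Lp_norm p (\<lambda>x. u n z x powr p) g"
    and f: "f \<in> Lp p (\<lambda>x. w x powr p)"
  shows "iterated_commutator T b k f \<in> Lp q (\<lambda>x. w x powr q)" (is ?thesis1)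
    and "Lp_norm q (\<lambda>x. w x powr q) (iterated_commutator T b k f)
      \<le> ennreal (fact k / r ^ k * \<Phi>) * Lp_norm p (\<lambda>x. w x powr p) f" (is ?thesis2)
proof -
  have [measurable]: "f \<in> borel_measurable lebesgue" using f by (simp add: Lp_def)
  obtain N where N: "Lp_norm p (\<lambda>x. w x powr p) f = ennreal N" "0 \<le> N"
    using f by (cases "Lp_norm p (\<lambda>x. w x powr p) f") (auto simp: Lp_def)
  \<comment> \<open>At a point \<open>x\<close>, \<open>a\<close> lists the Taylor coefficients of
    T(exp(zb)f) and \<open>c\<close> those of F(z), the same function times exp(-zb). By the
    binomial expansion, \<open>fact k * c x k\<close> is the iterated commutator.\<close>
  define a where "a = (\<lambda>x j. T (\<lambda>y. b y ^ j * f y) x / fact j)"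
  define c where "c = (\<lambda>x n. \<Sum>j\<le>n. (- b x) ^ (n - j) / fact (n - j) * a x j)"
  define F where "F = (\<lambda>z x. exp (- (z * b x)) * T (\<lambda>y. exp (z * b y) * f y) x)"
  note series = exp_series_operator[OF p q lin assms(6,7) w r \<Phi>(1) T\<^sub>0[unfolded v_def] f]
  have Tb [measurable]: "T (\<lambda>y. b y ^ j * f y) \<in> borel_measurable lebesgue" for j
    by (rule series(1))
  have c_eq: "iterated_commutator T b k f x = fact k * c x k" for x
    unfolding iterated_commutator_eq_sum c_def a_def sum_distrib_left
    by (intro sum.cong refl) (simp add: binomial_fact mult_ac)
  have "(\<lambda>x. iterated_commutator T b k f x) \<in> borel_measurable lebesgue"
    unfolding iterated_commutator_eq_sum by measurable
  then have [measurable]: "iterated_commutator T b k f \<in> borel_measurable lebesgue" .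
  define \<zeta> where "\<zeta> = (\<lambda>n m. cis (2 * pi * real m / real (Suc n)))"
  have norm_\<zeta>: "norm (of_real r * \<zeta> n m) = r" for n m
    using r by (simp add: \<zeta>_def norm_mult)
  \<comment> \<open>The exponential in \<open>u n z\<close> cancels that of exp(zb)f on the input
    side and equals the modulus of exp(-zb) on the output side. In both cases only the truncated
    weight remains.\<close>
  have FT: "(\<integral>\<^sup>+x. ennreal (norm (F z x) powr q * min (w x) (real (Suc n)) powr q) \<partial>lebesgue)
      \<le> ennreal ((\<Phi> * N) powr q)" and Fm: "F z \<in> borel_measurable lebesgue"
    if z: "norm z = r" for n z
  proof -
    define g where "g = (\<lambda>y. exp (z * b y) * f y)"
    have u0: "0 \<le> u n z x" for x using w by (simp add: u_def)
    have dom: "norm (g x) * u n z x \<le> 1 * (norm (f x) * w x)" for x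
    proof -
      have "norm (g x) * u n z x = norm (f x) * min (w x) (real (Suc n))"
      proof -
        have "norm (g x) * u n z x = (exp (Re (z * b x)) * exp (- Re (z * b x))) * (norm (f x) * min (w x) (real (Suc n)))"
          unfolding g_def u_def norm_mult[of _ "f x"] norm_exp_eq_Re by (simp only: mult_ac)
        then show ?thesis unfolding exp_minus_inverse by simp
      qed
      also have "\<dots> \<le> norm (f x) * w x" by (intro mult_left_mono) auto
      finally show ?thesis by simp
    qed
    have gm: "g \<in> borel_measurable lebesgue" unfolding g_def by measurable
    have g: "g \<in> Lp p (\<lambda>x. u n z x powr p)"
      "Lp_norm p (\<lambda>x. u n z x powr p) g \<le> ennreal (1 * N)"
      by (rule Lp_dominated[OF gm assms(6) f eq_refl[OF N(1)] _ N(2) _ u0 w(1) dom]; use p in simp)+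
    have "Lp_norm q (\<lambda>x. u n z x powr q) (T g) \<le> ennreal \<Phi> * Lp_norm p (\<lambda>x. u n z x powr p) g"
      using T[OF z g(1)] by blast
    also have "\<dots> \<le> ennreal \<Phi> * ennreal (1 * N)" by (intro mult_left_mono g) auto
    also have "\<dots> = ennreal (\<Phi> * N)" using \<Phi> by (simp add: ennreal_mult')
    finally have "(\<integral>\<^sup>+x. ennreal (norm (T g x) powr q * u n z x powr q) \<partial>lebesgue) \<le> ennreal ((\<Phi> * N) powr q)"
      using q \<Phi> N by (simp add: Lp_norm_le_iff)
    moreover have "norm (T g x) powr q * u n z x powr q = norm (F z x) powr q * min (w x) (real (Suc n)) powr q" for x
    proof -
      have "norm (T g x) * u n z x = norm (F z x) * min (w x) (real (Suc n))"
        unfolding F_def g_def u_def norm_mult[of "exp _"] norm_exp_eq_Re uminus_complex.sel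
        by (simp only: mult_ac)
      then have "(norm (T g x) * u n z x) powr q = (norm (F z x) * min (w x) (real (Suc n))) powr q"
        by simp
      then show ?thesis using u0 w by (simp add: powr_mult del: of_nat_Suc)
    qed
    ultimately show "(\<integral>\<^sup>+x. ennreal (norm (F z x) powr q * min (w x) (real (Suc n)) powr q) \<partial>lebesgue)
      \<le> ennreal ((\<Phi> * N) powr q)" by (simp only:)
    have [measurable]: "T g \<in> borel_measurable lebesgue"
      using T[OF z g(1)] by (simp add: Lp_def)
    have "F z = (\<lambda>x. exp (- (z * b x)) * T g x)" by (simp add: F_def g_def)
    then show "F z \<in> borel_measurable lebesgue" by simp
  qed
  \<comment> \<open>The index \<open>n\<close> controls both the number of roots of unity and the
    truncation level, so a single limit removes both approximations.\<close>
  define H where "H = (\<lambda>n x. (\<Sum>m<Suc n. ennreal (norm (F (of_real r * \<zeta> n m) x) powr q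
      * min (w x) (real (Suc n)) powr q)) / of_nat (Suc n))"
  have [measurable]: "F (of_real r * \<zeta> n m) \<in> borel_measurable lebesgue" for n m
    by (intro Fm norm_\<zeta>)
  have H_meas [measurable]: "H n \<in> borel_measurable lebesgue" for n
    unfolding H_def by measurable
  have H_int: "(\<integral>\<^sup>+x. H n x \<partial>lebesgue) \<le> ennreal ((\<Phi> * N) powr q)" for n
  proof -
    have "(\<integral>\<^sup>+x. H n x \<partial>lebesgue) = (\<Sum>m<Suc n. \<integral>\<^sup>+x. ennreal (norm (F (of_real r * \<zeta> n m) x) powr q
      * min (w x) (real (Suc n)) powr q) \<partial>lebesgue) / of_nat (Suc n)"
      unfolding H_def by (subst nn_integral_divide, measurable, subst nn_integral_sum, measurable)
    also have "\<dots> \<le> (\<Sum>m<Suc n. ennreal ((\<Phi> * N) powr q)) / of_nat (Suc n)"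
      by (intro divide_right_mono_ennreal sum_mono FT norm_\<zeta>)
    also have "\<dots> = ennreal ((\<Phi> * N) powr q)"
      by (simp add: ennreal_of_nat_eq_real_of_nat ennreal_mult'[symmetric] divide_ennreal del: sum.lessThan_Suc of_nat_Suc)
    finally show ?thesis .
  qed
  have "AE x in lebesgue. \<forall>n m. (\<lambda>j. a x j * (of_real r * \<zeta> n m) ^ j) sums
      T (\<lambda>y. exp (of_real r * \<zeta> n m * b y) * f y) x"
    unfolding a_def by (subst AE_all_countable, rule allI)+ (intro series(3) norm_\<zeta>)
  moreover have "AE x in lebesgue. summable (\<lambda>j. norm (a x j) * r ^ j)"
    unfolding a_def by (rule series(2))
  ultimately have "AE x in lebesgue. ennreal (norm (c x k * of_real r ^ k) powr q * w x powr q)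
      \<le> liminf (\<lambda>n. H n x)"
  proof eventually_elim
    case (elim x)
    \<comment> \<open>The discrete Cauchy formula for the coefficient \<open>c x k\<close>. Its
      modulus is at most the mean of the moduli of \<open>F\<close>, and the power mean inequality
      bounds the weighted \<open>q\<close>-th power of that mean by \<open>H n x\<close>.\<close>
    define A where "A = (\<lambda>n. (\<Sum>m<Suc n. cnj (\<zeta> n m) ^ k * F (of_real r * \<zeta> n m) x) / of_nat (Suc n))"
    have "(\<Sum>i. c x i * (of_real r * \<zeta> n m) ^ i) = F (of_real r * \<zeta> n m) x" for n m
      unfolding c_def F_def
      using Cauchy_product_exp(2)[OF elim(2) less_imp_le[OF r(1)] norm_\<zeta>[of n m], of "b x"]
        elim(1)[rule_format, of n m, THEN sums_unique] by simp
    moreover have "summable (\<lambda>i. norm (c x i) * r ^ i)"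
      unfolding c_def using Cauchy_product_exp(1)[OF elim(2) less_imp_le[OF r(1)]] .
    ultimately have "A \<longlonglongrightarrow> c x k * of_real r ^ k"
      using power_series_average_roots_unity[of r "c x" k] r
      unfolding A_def \<zeta>_def by simp
    moreover have "\<forall>\<^sub>F n in sequentially. min (w x) (real (Suc n)) = w x"
    proof -
      obtain n\<^sub>0 where "w x \<le> real n\<^sub>0" using real_arch_simple by blast
      then show ?thesis by (intro eventually_sequentiallyI[of n\<^sub>0]) auto
    qed
    then have "(\<lambda>n. min (w x) (real (Suc n))) \<longlonglongrightarrow> w x"
      by (rule tendsto_eventually)
    ultimately have "(\<lambda>n. norm (A n) powr q * min (w x) (real (Suc n)) powr q)
        \<longlonglongrightarrow> norm (c x k * of_real r ^ k) powr q * w x powr q"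
      using q w(1) by (intro tendsto_mult tendsto_powr' tendsto_norm tendsto_const) auto
    then have lim: "(\<lambda>n. ennreal (norm (A n) powr q * min (w x) (real (Suc n)) powr q))
        \<longlonglongrightarrow> ennreal (norm (c x k * of_real r ^ k) powr q * w x powr q)"
      by (rule tendsto_ennrealI)
    have le: "ennreal (norm (A n) powr q * min (w x) (real (Suc n)) powr q) \<le> H n x" for n
    proof -
      let ?S = "{..<Suc n}" and ?F = "\<lambda>m. norm (F (of_real r * \<zeta> n m) x)"
      have "norm (\<Sum>m<Suc n. cnj (\<zeta> n m) ^ k * F (of_real r * \<zeta> n m) x) \<le> (\<Sum>m<Suc n. ?F m)"
        by (intro sum_norm_le) (simp add: norm_mult norm_power \<zeta>_def)
      then have "norm (A n) \<le> (\<Sum>m\<in>?S. ?F m) / card ?S"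
        unfolding A_def norm_divide by (simp add: divide_right_mono del: sum.lessThan_Suc of_nat_Suc)
      then have "norm (A n) powr q \<le> ((\<Sum>m\<in>?S. ?F m) / card ?S) powr q"
        using q by (intro powr_mono2) auto
      also have "\<dots> \<le> (\<Sum>m\<in>?S. ?F m powr q) / card ?S"
        using q by (intro powr_average_le) auto
      finally have "norm (A n) powr q * min (w x) (real (Suc n)) powr q
          \<le> (\<Sum>m\<in>?S. ?F m powr q) / card ?S * min (w x) (real (Suc n)) powr q"
        by (intro mult_right_mono) auto
      also have "\<dots> = (\<Sum>m<Suc n. ?F m powr q * min (w x) (real (Suc n)) powr q) / real (Suc n)"
        by (simp add: sum_distrib_right del: sum.lessThan_Suc of_nat_Suc)
      finally show ?thesis
        unfolding H_def
        by (simp add: sum_nonneg ennreal_of_nat_eq_real_of_nat divide_ennreal ennreal_leI del: sum.lessThan_Suc of_nat_Suc)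
    qed
    show ?case
      using lim_imp_Liminf[OF sequentially_bot lim] Liminf_mono[of _ "\<lambda>n. H n x" sequentially] le
      by (metis (no_types, lifting) always_eventually)
  qed
  then have "(\<integral>\<^sup>+x. ennreal (norm (c x k * of_real r ^ k) powr q * w x powr q) \<partial>lebesgue)
      \<le> (\<integral>\<^sup>+x. liminf (\<lambda>n. H n x) \<partial>lebesgue)"
    by (rule nn_integral_mono_AE)
  also have "\<dots> \<le> liminf (\<lambda>n. \<integral>\<^sup>+x. H n x \<partial>lebesgue)"
    by (intro nn_integral_liminf H_meas)
  also have "\<dots> \<le> liminf (\<lambda>n. ennreal ((\<Phi> * N) powr q))"
    by (intro Liminf_mono always_eventually allI H_int)
  also have "\<dots> = ennreal ((\<Phi> * N) powr q)"
    by (simp add: Liminf_const)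
  finally have fatou: "(\<integral>\<^sup>+x. ennreal (norm (c x k * of_real r ^ k) powr q * w x powr q) \<partial>lebesgue)
      \<le> ennreal ((\<Phi> * N) powr q)" .
  have "(\<integral>\<^sup>+x. ennreal (norm (iterated_commutator T b k f x) powr q * w x powr q) \<partial>lebesgue)
      = (\<integral>\<^sup>+x. ennreal ((fact k / r ^ k) powr q) * ennreal (norm (c x k * of_real r ^ k) powr q * w x powr q) \<partial>lebesgue)"
  proof (rule nn_integral_cong)
    fix x
    have "norm (iterated_commutator T b k f x) = fact k / r ^ k * norm (c x k * of_real r ^ k)"
      using r unfolding c_eq by (simp add: norm_mult norm_power)
    then have "norm (iterated_commutator T b k f x) powr q
        = (fact k / r ^ k) powr q * norm (c x k * of_real r ^ k) powr q"
      using r by (simp only: powr_mult)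
    then show "ennreal (norm (iterated_commutator T b k f x) powr q * w x powr q)
        = ennreal ((fact k / r ^ k) powr q) * ennreal (norm (c x k * of_real r ^ k) powr q * w x powr q)"
      by (simp add: ennreal_mult'[symmetric] mult.assoc)
  qed
  also have "\<dots> = ennreal ((fact k / r ^ k) powr q) * (\<integral>\<^sup>+x. ennreal (norm (c x k * of_real r ^ k) powr q * w x powr q) \<partial>lebesgue)"
    unfolding c_def a_def by (intro nn_integral_cmult) measurable
  also have "\<dots> \<le> ennreal ((fact k / r ^ k) powr q) * ennreal ((\<Phi> * N) powr q)"
    by (intro mult_left_mono fatou) auto
  also have "\<dots> = ennreal ((fact k / r ^ k * \<Phi> * N) powr q)"
  proof -
    have "(fact k / r ^ k * (\<Phi> * N)) powr q = (fact k / r ^ k) powr q * (\<Phi> * N) powr q"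
      using r \<Phi> N by (intro powr_mult) 
    then show ?thesis by (simp only: ennreal_mult'[symmetric] powr_ge_zero mult.assoc)
  qed
  finally have "Lp_norm q (\<lambda>x. w x powr q) (iterated_commutator T b k f) \<le> ennreal (fact k / r ^ k * \<Phi> * N)"
    using q r \<Phi> N by (simp add: Lp_norm_le_iff)
  also have "\<dots> = ennreal (fact k / r ^ k * \<Phi>) * Lp_norm p (\<lambda>x. w x powr p) f"
    unfolding N using r \<Phi> N(2) by (intro ennreal_mult) auto
  finally show ?thesis2 .
  then have "Lp_norm q (\<lambda>x. w x powr q) (iterated_commutator T b k f) < top"
    unfolding N using ennreal_mult_less_top le_less_trans by fastforce
  then show ?thesis1 by (simp add: Lp_def)
qed

section \<open>Choice of radius and constants, and the estimate for all commutators\<close>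

theorem theorem1p1:
  fixes \<phi> :: "real \<Rightarrow> real" and w :: "real^'n \<Rightarrow> real" and \<theta> \<eta> s :: real
  assumes "mono_on {1..} \<phi>" and "\<forall>t\<ge>1. 0 \<le> \<phi> t"
    and "0 < \<theta>" and "1 < s" and "1 < \<eta>"
    and "weight w" and "(\<lambda>x. w x powr (\<theta> * \<eta>)) \<in> A_class s"
  shows "\<exists>(C::real) (C'::nat \<Rightarrow> real).
    \<forall>(p::real) (q::real) (D::(real^'n \<Rightarrow> complex) set) T.
      1 < p \<longrightarrow> 1 < q \<longrightarrow> linear_operator_on D T \<longrightarrow>
      (\<forall>v. weight v \<longrightarrow> (\<lambda>x. v x powr \<theta>) \<in> A_class s \<longrightarrow>
         (\<forall>f \<in> Lp p (\<lambda>x. v x powr p).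
            f \<in> D \<and> T f \<in> Lp q (\<lambda>x. v x powr q) \<and>
            Lp_norm q (\<lambda>x. v x powr q) (T f)
              \<le> ennreal (\<phi> (enn2real (A_const s (\<lambda>x. v x powr \<theta>)))) *
                Lp_norm p (\<lambda>x. v x powr p) f)) \<longrightarrow>
      (\<forall>b\<in>BMO. \<forall>f \<in> Lp p (\<lambda>x. w x powr p).
         (commutator T b f \<in> Lp q (\<lambda>x. w x powr q) \<and>
          Lp_norm q (\<lambda>x. w x powr q) (commutator T b f)
            \<le> ennreal C * bmo_norm b * Lp_norm p (\<lambda>x. w x powr p) f) \<and>
         (\<forall>k\<ge>2.
            iterated_commutator T b k f \<in> Lp q (\<lambda>x. w x powr q) \<and>
            Lp_norm q (\<lambda>x. w x powr q) (iterated_commutator T b k f)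
              \<le> ennreal (C' k) * bmo_norm b ^ k * Lp_norm p (\<lambda>x. w x powr p) f))"
proof -
  note \<phi>_mono = assms(1) and \<phi>_nonneg = assms(2) and \<theta> = assms(3) and s = assms(4) and \<eta> = assms(5)
    and w = assms(6) and wA = assms(7)
  have [measurable]: "w \<in> borel_measurable lebesgue" using w by (rule weight_measurable)
  have w0: "0 \<le> w x" for x using w by (simp add: weight_def)
  have w_pos: "AE x in lebesgue. 0 < w x"
  proof -
    have "AE x in lebesgue. 0 < w x powr (\<theta> * \<eta>)" using wA by (simp add: A_class_def)
    then show ?thesis by eventually_elim (use w0 in \<open>auto simp: less_le\<close>)
  qed
  define K\<^sub>0 where "K\<^sub>0 = enn2real (A_const s (\<lambda>x. w x powr (\<theta> * \<eta>)))"
  \<comment> \<open>\<open>K\<close> bounds the constants of all truncations of w to the power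
    \<theta>\<eta>, and \<open>K'\<close> those of the \<theta>-th powers after the exponential
    perturbation. \<Lambda> majorises every multiplier in the smallness conditions; its summand 1
    serves local integrability.\<close>
  define K where "K = 2 powr (s - 1) * K\<^sub>0"
  define K' where "K' = K powr (1 / \<eta>) * 2 powr (s / conj_exp \<eta>)"
  define \<Lambda> where "\<Lambda> = 1 + \<theta> * conj_exp \<eta> + \<theta> * conj_exp \<eta> * (conj_exp s - 1)"
  have K\<^sub>0: "A_const s (\<lambda>x. w x powr (\<theta> * \<eta>)) = ennreal K\<^sub>0"
    using wA by (simp add: K\<^sub>0_def A_class_def)
  then have "1 \<le> K\<^sub>0" using A_const_ge_1[OF wA s] by simp
  moreover have "1 \<le> 2 powr (s - 1)" using s by (intro ge_one_powr_ge_zero) auto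
  ultimately have K: "K\<^sub>0 \<le> K" "1 \<le> K"
    unfolding K_def using mult_right_mono[of 1 "2 powr (s - 1)" K\<^sub>0] by linarith+
  have "1 \<le> K powr (1 / \<eta>)" "1 \<le> 2 powr (s / conj_exp \<eta>)"
    using K s \<eta> conj_exp(1)[OF \<eta>] by (auto intro!: ge_one_powr_ge_zero)
  then have K': "1 \<le> K'" unfolding K'_def using mult_mono[of 1 "K powr (1 / \<eta>)" 1] by simp
  have \<Lambda>: "1 \<le> \<Lambda>" "\<theta> * conj_exp \<eta> \<le> \<Lambda>" "\<theta> * conj_exp \<eta> * (conj_exp s - 1) \<le> \<Lambda>"
    using \<theta> conj_exp(1)[OF s] conj_exp(1)[OF \<eta>] by (auto simp: \<Lambda>_def)
  define \<Phi> where "\<Phi> = \<phi> K'"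
  have \<Phi>: "0 \<le> \<Phi>" using \<phi>_nonneg K' by (simp add: \<Phi>_def)
  \<comment> \<open>Cauchy's factor k! \<Phi> / r^k at the radius r = 1 / (4\<Lambda>B), where B is
    the BMO norm, with the powers of B split off.\<close>
  define C where "C = (\<lambda>k::nat. fact k * (4 * \<Lambda>) ^ k * \<Phi>)"
  have main: "iterated_commutator T b k f \<in> Lp q (\<lambda>x. w x powr q) \<and>
      Lp_norm q (\<lambda>x. w x powr q) (iterated_commutator T b k f)
        \<le> ennreal (C k) * bmo_norm b ^ k * Lp_norm p (\<lambda>x. w x powr p) f"
    if p: "1 < p" and q: "1 < q" and lin: "linear_operator_on D T"
      and T: "\<forall>v. weight v \<longrightarrow> (\<lambda>x. v x powr \<theta>) \<in> A_class s \<longrightarrow>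
         (\<forall>f \<in> Lp p (\<lambda>x. v x powr p).
            f \<in> D \<and> T f \<in> Lp q (\<lambda>x. v x powr q) \<and>
            Lp_norm q (\<lambda>x. v x powr q) (T f)
              \<le> ennreal (\<phi> (enn2real (A_const s (\<lambda>x. v x powr \<theta>)))) *
                Lp_norm p (\<lambda>x. v x powr p) f)"
      and b: "b \<in> BMO" and f: "f \<in> Lp p (\<lambda>x. w x powr p)" and k: "1 \<le> k"
    for p q D T b f and k :: nat
  proof -
    have [measurable]: "b \<in> borel_measurable lebesgue"
      using b by (auto simp: BMO_def intro: locally_integrable_measurable)
    define B where "B = enn2real (bmo_norm b)"
    have B: "bmo_norm b = ennreal B" "0 \<le> B" using b by (auto simp: B_def BMO_def)
    \<comment> \<open>Monotonicity of \<phi> replaces its value at the individual weight constant by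
      \<Phi> = \<phi>(\<open>K'\<close>).\<close>
    have T': "g \<in> D \<and> T g \<in> Lp q (\<lambda>x. v x powr q) \<and>
        Lp_norm q (\<lambda>x. v x powr q) (T g) \<le> ennreal \<Phi> * Lp_norm p (\<lambda>x. v x powr p) g"
      if v: "weight v" "(\<lambda>x. v x powr \<theta>) \<in> A_class s" "A_const s (\<lambda>x. v x powr \<theta>) \<le> ennreal K'"
        and g: "g \<in> Lp p (\<lambda>x. v x powr p)" for v g
    proof -
      let ?A = "A_const s (\<lambda>x. v x powr \<theta>)"
      have "1 \<le> enn2real ?A"
        using enn2real_mono[OF A_const_ge_1[OF v(2) s]] v(2) by (simp add: A_class_def)
      moreover have "enn2real ?A \<le> K'"
        using enn2real_mono[OF v(3)] K' by simp
      ultimately have "\<phi> (enn2real ?A) \<le> \<Phi>"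
        unfolding \<Phi>_def by (intro mono_onD[OF \<phi>_mono]) auto
      then have "ennreal (\<phi> (enn2real ?A)) * Lp_norm p (\<lambda>x. v x powr p) g
          \<le> ennreal \<Phi> * Lp_norm p (\<lambda>x. v x powr p) g"
        by (intro mult_right_mono ennreal_leI) auto
      then show ?thesis using T v(1,2) g by (meson order_trans)
    qed
    have bound: "iterated_commutator T b k f \<in> Lp q (\<lambda>x. w x powr q)"
      "Lp_norm q (\<lambda>x. w x powr q) (iterated_commutator T b k f)
        \<le> ennreal (fact k / r ^ k * \<Phi>) * Lp_norm p (\<lambda>x. w x powr p) f"
      if r: "0 < r" and r\<Lambda>: "2 * r * \<Lambda> * B < 1" for r
    proof -
      define \<rho> where "\<rho> = 2 * r"
      have small: "\<rho>' * a * enn2real (bmo_norm b) < 1" if "0 \<le> \<rho>'" "\<rho>' \<le> \<rho>" "a \<le> \<Lambda>" for a \<rho>'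
      proof -
        have "\<rho>' * a \<le> \<rho>' * \<Lambda>" using that by (intro mult_left_mono)
        also have "\<dots> \<le> \<rho> * \<Lambda>" using that \<Lambda>(1) by (intro mult_right_mono) auto
        finally have "\<rho>' * a \<le> \<rho> * \<Lambda>" .
        then have "\<rho>' * a * B \<le> \<rho> * \<Lambda> * B" using B by (intro mult_right_mono)
        also have "\<dots> < 1" using r\<Lambda> by (simp add: \<rho>_def)
        finally show ?thesis by (simp add: B_def)
      qed
      have \<rho>: "0 \<le> r" "r \<le> \<rho>" "0 \<le> \<rho>" "\<rho> \<le> \<rho>" using r by (auto simp: \<rho>_def)
      have v_A: "(\<lambda>x. (w x * exp (- \<rho> * norm (b x))) powr \<theta>) \<in> A_class s"
        "A_const s (\<lambda>x. (w x * exp (- \<rho> * norm (b x))) powr \<theta>) \<le> ennreal K'"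
      proof -
        \<comment> \<open>The constant is the value of the exponent at the average of
          \<open>b\<close>, and the reverse triangle inequality gives the bound.\<close>
        have osc: "\<exists>c. \<forall>x. \<bar>- \<rho> * norm (b x) - c\<bar> \<le> \<rho> * norm (b x - average Q b)" for Q
        proof (intro exI allI)
          fix x
          have "\<bar>- \<rho> * norm (b x) - - \<rho> * norm (average Q b)\<bar> = \<rho> * \<bar>norm (b x) - norm (average Q b)\<bar>"
            using \<rho> by (simp add: abs_mult abs_minus_commute flip: right_diff_distrib)
          also have "\<dots> \<le> \<rho> * norm (b x - average Q b)"
            using \<rho> by (intro mult_left_mono norm_triangle_ineq3)
          finally show "\<bar>- \<rho> * norm (b x) - - \<rho> * norm (average Q b)\<bar> \<le> \<rho> * norm (b x - average Q b)" .
        qed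
        have "A_const s (\<lambda>x. w x powr (\<theta> * \<eta>)) \<le> ennreal K"
          unfolding K\<^sub>0 using K by (intro ennreal_leI)
        then show "(\<lambda>x. (w x * exp (- \<rho> * norm (b x))) powr \<theta>) \<in> A_class s"
          "A_const s (\<lambda>x. (w x * exp (- \<rho> * norm (b x))) powr \<theta>) \<le> ennreal K'"
          unfolding K'_def
          by - (rule A_class_BMO_exp_mult[OF s \<eta> \<theta> _ w0 wA _ b \<rho>(3) _ _ _ osc]; (use \<Lambda> \<rho> in \<open>intro small\<close>)?; simp)+
      qed
      have v_weight: "weight (\<lambda>x. w x * exp (- \<rho> * norm (b x)))"
        using w0 \<rho> by (intro weight_mono[OF w]) (auto simp: mult_left_le)
      have u_A: "(\<lambda>x. (min (w x) m * exp (- Re (z * b x))) powr \<theta>) \<in> A_class s \<and>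
        A_const s (\<lambda>x. (min (w x) m * exp (- Re (z * b x))) powr \<theta>) \<le> ennreal K' \<and>
        weight (\<lambda>x. min (w x) m * exp (- Re (z * b x)))"
        if z: "norm z = r" and "0 < m" for z m
      proof -
        have osc: "\<exists>c. \<forall>x. \<bar>- Re (z * b x) - c\<bar> \<le> r * norm (b x - average Q b)" for Q
        proof (intro exI allI)
          fix x
          have "\<bar>- Re (z * b x) - - Re (z * average Q b)\<bar> = \<bar>Re (z * (b x - average Q b))\<bar>"
            by (simp add: right_diff_distrib algebra_simps)
          also have "\<dots> \<le> norm (z * (b x - average Q b))" by (rule abs_Re_le_cmod)
          finally show "\<bar>- Re (z * b x) - - Re (z * average Q b)\<bar> \<le> r * norm (b x - average Q b)"
            by (simp add: norm_mult z)
        qed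
        \<comment> \<open>An increasing power commutes with the minimum, so truncating w at
          \<open>m\<close> truncates its power at the corresponding level.\<close>
        have "(\<lambda>x. min (w x) m powr (\<theta> * \<eta>)) = (\<lambda>x. min (w x powr (\<theta> * \<eta>)) (m powr (\<theta> * \<eta>)))"
        proof
          fix x
          show "min (w x) m powr (\<theta> * \<eta>) = min (w x powr (\<theta> * \<eta>)) (m powr (\<theta> * \<eta>))"
            using w0[of x] \<open>0 < m\<close> \<theta> \<eta> powr_mono2[of "\<theta> * \<eta>" "w x" m] powr_mono2[of "\<theta> * \<eta>" m "w x"]
            by (auto simp: min_def)
        qed
        then have mA: "(\<lambda>x. min (w x) m powr (\<theta> * \<eta>)) \<in> A_class s"
          "A_const s (\<lambda>x. min (w x) m powr (\<theta> * \<eta>)) \<le> ennreal K"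
          using A_class_min[OF wA s eq_refl[OF K\<^sub>0], of "m powr (\<theta> * \<eta>)"] \<open>0 < m\<close>
          by (simp_all add: K_def)
        have m0: "0 \<le> min (w x) m" for x using w0 \<open>0 < m\<close> by simp
        have "(\<lambda>x. (min (w x) m * exp (- Re (z * b x))) powr \<theta>) \<in> A_class s"
          "A_const s (\<lambda>x. (min (w x) m * exp (- Re (z * b x))) powr \<theta>) \<le> ennreal K'"
          unfolding K'_def
          by (rule A_class_BMO_exp_mult[OF s \<eta> \<theta> _ m0 mA b \<rho>(1) _ _ _ osc];
            (use \<Lambda> \<rho> in \<open>intro small\<close>)?; measurable)+
        \<comment> \<open>Truncation pays off here: the perturbed weight is dominated by a constant
          times an exponential, which is locally integrable.\<close>
        moreover have "weight (\<lambda>x. m * exp (- Re (z * b x)))"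
          using small[of r 1] \<rho> \<Lambda> \<open>0 < m\<close> by (intro BMO_exp_weight[OF b \<rho>(1) _ _ _ osc]) auto
        then have "weight (\<lambda>x. min (w x) m * exp (- Re (z * b x)))"
          using m0 by (intro weight_mono[OF \<open>weight (\<lambda>x. m * exp (- Re (z * b x)))\<close>]) auto
        ultimately show ?thesis by blast
      qed
      show "iterated_commutator T b k f \<in> Lp q (\<lambda>x. w x powr q)"
        "Lp_norm q (\<lambda>x. w x powr q) (iterated_commutator T b k f)
          \<le> ennreal (fact k / r ^ k * \<Phi>) * Lp_norm p (\<lambda>x. w x powr p) f"
        by (rule iterated_commutator_bound[OF p q lin _ _ w0 w_pos r _ \<Phi> \<Phi> T'[OF v_weight v_A] _ f];
          (use r in \<open>simp add: \<rho>_def\<close>)?; use T' u_A in force)+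
    qed
    show ?thesis
    proof (cases "B = 0")
      case False
      then have "0 < B" using B by simp
      define r where "r = 1 / (4 * \<Lambda> * B)"
      have "0 < r" "2 * r * \<Lambda> * B < 1"
        using \<open>0 < B\<close> \<Lambda>(1) by (auto simp: r_def)
      note bound[OF this]
      moreover have "ennreal (fact k / r ^ k * \<Phi>) = ennreal (C k) * bmo_norm b ^ k"
      proof -
        have "fact k / r ^ k * \<Phi> = C k * B ^ k"
          by (simp add: r_def C_def power_divide power_mult_distrib)
        then show ?thesis
          using B \<Phi> \<Lambda>(1) by (simp add: ennreal_mult'' ennreal_power)
      qed
      ultimately show ?thesis by simp
    next
      case True
      \<comment> \<open>With vanishing BMO norm every radius is admissible. Since \<open>k\<close>
        \<ge> 1, letting r = \<open>Suc n\<close> tend to infinity forces the norm of the commutator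
        to be 0.\<close>
      obtain N where N: "Lp_norm p (\<lambda>x. w x powr p) f = ennreal N" "0 \<le> N"
        using f by (cases "Lp_norm p (\<lambda>x. w x powr p) f") (auto simp: Lp_def)
      have le: "Lp_norm q (\<lambda>x. w x powr q) (iterated_commutator T b k f) \<le> ennreal (fact k * \<Phi> * N / real (Suc n))" for n
      proof -
        have "real (Suc n) ^ 1 \<le> real (Suc n) ^ k" using k by (intro power_increasing) auto
        then have "fact k * \<Phi> * N / real (Suc n) ^ k \<le> fact k * \<Phi> * N / real (Suc n)"
          using \<Phi> N by (intro divide_left_mono) auto
        have "Lp_norm q (\<lambda>x. w x powr q) (iterated_commutator T b k f)
            \<le> ennreal (fact k / real (Suc n) ^ k * \<Phi>) * ennreal N"
          using bound(2)[of "real (Suc n)"] True N(1) by simp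
        also have "\<dots> = ennreal (fact k * \<Phi> * N / real (Suc n) ^ k)"
          using \<Phi> N by (simp add: ennreal_mult'[symmetric])
        also have "\<dots> \<le> ennreal (fact k * \<Phi> * N / real (Suc n))"
          by (rule ennreal_leI) fact
        finally show ?thesis .
      qed
      have "(\<lambda>n. ennreal (fact k * \<Phi> * N / real (Suc n))) \<longlonglongrightarrow> ennreal 0"
        by (intro tendsto_ennrealI LIMSEQ_Suc[OF lim_const_over_n])
      then have "Lp_norm q (\<lambda>x. w x powr q) (iterated_commutator T b k f) \<le> 0"
        using le by (intro LIMSEQ_le_const[where X="\<lambda>n. ennreal (fact k * \<Phi> * N / real (Suc n))"]) auto
      then show ?thesis
        using bound(1)[of 1] True by simp
    qed
  qed
  show ?thesis
  proof (intro exI[of _ "C 1"] exI[of _ C] allI impI ballI conjI)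
    fix p q :: real and D :: "(real^'n \<Rightarrow> complex) set" and T and b f :: "real^'n \<Rightarrow> complex"
    assume *: "1 < p" "1 < q" "linear_operator_on D T"
      "\<forall>v. weight v \<longrightarrow> (\<lambda>x. v x powr \<theta>) \<in> A_class s \<longrightarrow>
         (\<forall>f \<in> Lp p (\<lambda>x. v x powr p).
            f \<in> D \<and> T f \<in> Lp q (\<lambda>x. v x powr q) \<and>
            Lp_norm q (\<lambda>x. v x powr q) (T f)
              \<le> ennreal (\<phi> (enn2real (A_const s (\<lambda>x. v x powr \<theta>)))) *
                Lp_norm p (\<lambda>x. v x powr p) f)"
      "b \<in> BMO" "f \<in> Lp p (\<lambda>x. w x powr p)"
    show "commutator T b f \<in> Lp q (\<lambda>x. w x powr q)"
      and "Lp_norm q (\<lambda>x. w x powr q) (commutator T b f)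
            \<le> ennreal (C 1) * bmo_norm b * Lp_norm p (\<lambda>x. w x powr p) f"
      using main[OF *, of 1] by simp_all
    fix k :: nat
    assume "2 \<le> k"
    then show "iterated_commutator T b k f \<in> Lp q (\<lambda>x. w x powr q)"
      and "Lp_norm q (\<lambda>x. w x powr q) (iterated_commutator T b k f)
              \<le> ennreal (C k) * bmo_norm b ^ k * Lp_norm p (\<lambda>x. w x powr p) f"
      using main[OF *, of k] by simp_all
  qed
qed

end
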